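(* Let $\gamma\in(0,1]$, let $D=A_2^TA_2$ or $D=\|A_2\|^2I_{n_2}$, and let $\{x^k\}=\{(x_1^k,x_2^k)\}$, $\{\lambda^k\}$ be generated, for $k\ge0$, by Algorithm 2 (given in the context). With $\breve x^k,\widetilde x^k,\bar x^k,\widetilde\lambda^k,v^k=(\bar x_2^k,\lambda^k)$, $\widetilde v^k=(\widetilde x_2^k,\widetilde\lambda^k)$, $\widetilde u^k=(\widetilde x^k,\widetilde\lambda^k)$ and $Q^k,M^k,H^k,G^k$ as defined in the context, the following hold. (i) Suppose $\sigma=0$, $\beta^k=\beta/\tau^k$ with $\beta>0$, and $1/\tau^{k-1}=(1-\tau^k)/\tau^k$ for $k\ge0$, $\tau^{-1}\in(0,1)$. Then for all $k\ge 0$, with $c^k=(1-\gamma)(1-\tau^k)\beta^k$, one has $\widetilde x^k=\frac1{\tau^k}\breve x^k-\frac{1-\tau^k}{\tau^k}\breve x^{k-1}$, $$\frac{1}{\tau^k}[f(x)-f(\breve x^k)]-\frac{1}{\tau^{k-1}}[f(x)-f(\breve x^{k-1})]+(u-\widetilde u^k)^TF(\widetilde u^k)+c^k(A(x-\widetilde x^k))^T(A\breve x^{k-1}-b)\ge (v-\widetilde v^k)^TQ^k(v^k-\widetilde v^k)\quad\forall u,$$ and $v^{k+1}=v^k-M^k(v^k-\widetilde v^k)$. Moreover $Q^k=H^kM^k$, $G^k=(Q^k)^T+Q^k-(M^k)^TH^kM^k$, and with $H_0^k=H^k=\begin{pmatrix}\beta D&0\\0&\frac1{\gamma\beta}I_l\end{pmatrix}$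 and some $\varTheta^k\ge0$ satisfying $\varTheta^{k+1}-\varTheta^k\ge(1-\gamma)\tau^k\beta^k\|A\widetilde x^k-b\|^2$, $$\|v^{k+1}-v'\|^2_{H^k}-\|v^k-v'\|^2_{H^k}+\|v^k-\widetilde v^k\|^2_{G^k}\ge\|v^{k+1}-v'\|^2_{H_0^{k+1}}-\|v^k-v'\|^2_{H_0^k}+\varTheta^{k+1}-\varTheta^k$$ for all $v'=(x_2',\lambda)$ with $x'=(x_1',x_2')\in\Omega$, $\lambda\in\mathbb{R}^l$. (ii) Suppose $f_2$ is $\sigma$-strongly convex with $\sigma>0$, $\beta^k=\beta/(\tau^k)^2$ with $\beta>0$ and $$\frac1{\tau^k}\Big(\frac{\beta}{\tau^k}+\frac{\sigma}{\sigma_{\max}(D)}\Big)\ge\frac{\beta}{(\tau^{k+1})^2}\quad\text{for all }k\ge 0,$$ and $\tau^k>0$, $1/(\tau^{k-1})^2=(1-\tau^k)/(\tau^k)^2$ for $k\ge0$, $\tau^{-1}\in(0,1)$. Then for all $k\ge0$, with $c^k=(1-\gamma)(1-\tau^k)\beta^k/\tau^k$, $R=D/\sigma_{\max}(D)$, $z=x_2$, $z^k=\widetilde x_2^k$, one has $\widetilde x^k=\frac1{\tau^k}\breve x^k-\frac{1-\tau^k}{\tau^k}\breve x^{k-1}$, $$\frac{1}{(\tau^k)^2}[f(x)-f(\breve x^k)]-\frac{1}{(\tau^{k-1})^2}[f(x)-f(\breve x^{k-1})]+\frac1{\tau^k}(u-\widetilde u^k)^TF(\widetilde u^k)+c^k(A(x-\widetilde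 x^k))^T(A\breve x^{k-1}-b)$$ $$\ge\frac1{\tau^k}\Big[(v-\widetilde v^k)^TQ^k(v^k-\widetilde v^k)+\frac\sigma2\|z^k-z\|_R^2\Big]\quad\forall u,$$ and $v^{k+1}=v^k-M^k(v^k-\widetilde v^k)$. Moreover $Q^k=H^kM^k$, $G^k=(Q^k)^T+Q^k-(M^k)^TH^kM^k$, and with $H_0^k=\frac1{\tau^k}H^k=\begin{pmatrix}\frac{\beta}{(\tau^k)^2}D&0\\0&\frac1{\gamma\beta}I_l\end{pmatrix}$ and some $\varTheta^k\ge0$ satisfying $\varTheta^{k+1}-\varTheta^k\ge(1-\gamma)\beta^k\|A\widetilde x^k-b\|^2$, $$\frac1{\tau^k}\Big(\|v^{k+1}-v'\|^2_{H^k}+\sigma\|z^k-z'\|_R^2-\|v^k-v'\|^2_{H^k}+\|v^k-\widetilde v^k\|^2_{G^k}\Big)\ge\|v^{k+1}-v'\|^2_{H_0^{k+1}}-\|v^k-v'\|^2_{H_0^k}+\varTheta^{k+1}-\varTheta^k$$ for all $v'=(x_2',\lambda)$, $z'=x_2'$, with $x'=(x_1',x_2')\in\Omega$, $\lambda\in\mathbb{R}^l$.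
   Context: Problem (P2): minimize $f(x)=f_1(x_1)+f_2(x_2)$ subject to $Ax:=A_1x_1+A_2x_2=b$, with $f_i:\mathbb{R}^{n_i}\to\mathbb{R}$ closed proper convex, $A_i\in\mathbb{R}^{l\times n_i}$, $b\in\mathbb{R}^l$, $\Omega=\{x:Ax=b\}$; $f_2$ is $\sigma$-strongly convex with $\sigma\ge0$, i.e. $f_2(y)\ge f_2(x)+\langle g,y-x\rangle+\frac\sigma2\|y-x\|^2$ for all $x,y$, $g\in\partial f_2(x)$. $u=(x_1,x_2,\lambda)$, $v=(x_2,\lambda)$, $F(u)=(-A_1^T\lambda,-A_2^T\lambda,Ax-b)$. $\|w\|_D^2:=w^TDw$; $\sigma_{\max}(D)$ is the largest eigenvalue of $D$. Let $\beta^k>0$ and $\varphi^k(x_1,x_2,\lambda):=-\lambda^T(A_1x_1+A_2x_2-b)+\frac{\beta^k}2\|A_1x_1+A_2x_2-b\|^2$. Algorithm 2 (given $x^{-1},x^0,\lambda^0$; minimizers are assumed to exist): for $k\ge0$, - $\hat\lambda^k=\lambda^k+\gamma(1-\tau^k)\beta^k(Ax^k-b)$; - $\hat x^k=x^k+\frac{\tau^k(1-\tau^{k-1})}{\tau^{k-1}}(x^k-x^{k-1})$; - $x_1^{k+1}\in\arg\min_{x_1}\{f_1(x_1)+x_1^T\nabla_{x_1}\varphi^k(\hat x_1^k,\hat x_2^k,\hat\lambda^k)+\frac{\beta^k}2\|x_1-\hat x_1^k\|^2_{A_1^TA_1}\}$; - $x_2^{k+1}\in\arg\min_{x_2}\{f_2(x_2)+x_2^T\nabla_{x_2}\varphi^k(x_1^{k+1},\hat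 x_2^k,\hat\lambda^k)+\frac{\beta^k}2\|x_2-\hat x_2^k\|_D^2+\frac{\sigma(1-\tau^k)}{2\tau^k}\|x_2-x_2^k\|^2_{D/\sigma_{\max}(D)}\}$ (the last term is absent if $\sigma=0$); - $\lambda^{k+1}=\lambda^k-\gamma\tau^k\beta^k(A\bar x^{k+1}-b)$. Derived quantities: $\bar x^{k+1}:=x^{k+1}/\tau^k-(1-\tau^k)x^k/\tau^k$ ($k\ge-1$); $\breve x^k:=x^{k+1}$; $\widetilde x^k:=\bar x^{k+1}$; $\widetilde\lambda^k:=\lambda^k-\tau^k\beta^k(A_1\widetilde x_1^k+A_2\bar x_2^k-b)$. Matrices: $Q^k=\begin{pmatrix}\tau^k\beta^kD&0\\-A_2&\frac1{\tau^k\beta^k}I_l\end{pmatrix}$, $M^k=\begin{pmatrix}I_{n_2}&0\\-\gamma\tau^k\beta^kA_2&\gamma I_l\end{pmatrix}$, $H^k=\begin{pmatrix}\tau^k\beta^kD&0\\0&\frac1{\gamma\tau^k\beta^k}I_l\end{pmatrix}$, $G^k=\begin{pmatrix}\tau^k\beta^k(D-\gamma A_2^TA_2)&-(1-\gamma)A_2^T\\-(1-\gamma)A_2&\frac{2-\gamma}{\tau^k\beta^k}I_l\end{pmatrix}$. *)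

theory Defs
  imports "HOL-Analysis.Analysis"
begin

subsection \<open>Convex analysis\<close>

text \<open>Convex functions take values in the extended reals; a real-valued convex function
  \<open>h\<close> is the special case \<open>\<lambda>x. ereal (h x)\<close>, for which closedness and properness are automatic.
  The library's \<open>epigraph\<close> is for real-valued functions only.\<close>

definition eepigraph :: "('a::euclidean_space \<Rightarrow> ereal) \<Rightarrow> ('a \<times> real) set" where
  "eepigraph f = {(x, t). f x \<le> ereal t}"

definition closed_proper_convex :: "('a::euclidean_space \<Rightarrow> ereal) \<Rightarrow> bool" where
  "closed_proper_convex f \<longleftrightarrow>
     closed (eepigraph f) \<and> convex (eepigraph f) \<and> (\<forall>x. f x \<noteq> -\<infinity>) \<and> (\<exists>x. f x \<noteq> \<infinity>)"

definition subdiff :: "('a::euclidean_space \<Rightarrow> ereal) \<Rightarrow> 'a \<Rightarrow> 'a set" where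
  "subdiff f x = {g. \<forall>y. f y \<ge> f x + ereal (g \<bullet> (y - x))}"

text \<open>The modulus \<open>\<sigma> = 0\<close> is allowed and imposes nothing.\<close>

definition strongly_convex :: "real \<Rightarrow> ('a::euclidean_space \<Rightarrow> ereal) \<Rightarrow> bool" where
  "strongly_convex \<sigma> f \<longleftrightarrow>
     (\<forall>x y. \<forall>g \<in> subdiff f x. f y \<ge> f x + ereal (g \<bullet> (y - x) + \<sigma> / 2 * (norm (y - x))\<^sup>2))"

definition grad :: "('a::euclidean_space \<Rightarrow> real) \<Rightarrow> 'a \<Rightarrow> 'a" where
  "grad h x = (THE g. GDERIV h x :> g)"


subsection \<open>Matrices\<close>

text \<open>The quadratic form \<open>\<parallel>w\<parallel>\<^sub>D\<^sup>2\<close>; \<open>D\<close> is not required to be positive semidefinite.\<close>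

definition qform :: "real^'n^'n \<Rightarrow> real^'n \<Rightarrow> real" where
  "qform D w = w \<bullet> (D *v w)"

text \<open>Largest (real) eigenvalue; only used for symmetric matrices, where the set is finite and
  nonempty.\<close>

definition sigma_max :: "real^'n^'n \<Rightarrow> real" where
  "sigma_max D = Max {\<mu>. \<exists>w. w \<noteq> 0 \<and> D *v w = \<mu> *\<^sub>R w}"

text \<open>Block vectors and matrices are indexed by a sum type, so that block products and transposes
  are the library's matrix product and transpose.\<close>

definition stack :: "real^'m \<Rightarrow> real^'n \<Rightarrow> real^('m + 'n)" where
  "stack y z = (\<chi> i. case i of Inl a \<Rightarrow> y $ a | Inr c \<Rightarrow> z $ c)"

definition block ::
  "real^'n^'m \<Rightarrow> real^'p^'m \<Rightarrow> real^'n^'q \<Rightarrow> real^'p^'q \<Rightarrow> real^('n + 'p)^('m + 'q)" where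
  "block P Q R S = (\<chi> i j. case i of
       Inl a \<Rightarrow> (case j of Inl c \<Rightarrow> P $ a $ c | Inr d \<Rightarrow> Q $ a $ d)
     | Inr e \<Rightarrow> (case j of Inl c \<Rightarrow> R $ e $ c | Inr d \<Rightarrow> S $ e $ d))"

text \<open>In the following, \<open>t\<close> and \<open>\<beta>\<close> stand for \<open>\<tau>\<^sup>k\<close> and \<open>\<beta>\<^sup>k\<close>.\<close>

definition Qmat :: "real^'n2^'l \<Rightarrow> real^'n2^'n2 \<Rightarrow> real \<Rightarrow> real \<Rightarrow> real^('n2 + 'l)^('n2 + 'l)" where
  "Qmat A2 D t \<beta> = block ((t * \<beta>) *\<^sub>R D) 0 (- A2) ((1 / (t * \<beta>)) *\<^sub>R mat 1)"

definition Mmat :: "real^'n2^'l \<Rightarrow> real \<Rightarrow> real \<Rightarrow> real \<Rightarrow> real^('n2 + 'l)^('n2 + 'l)" where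
  "Mmat A2 \<gamma> t \<beta> = block (mat 1) 0 (- (\<gamma> * t * \<beta>) *\<^sub>R A2) (\<gamma> *\<^sub>R mat 1)"

definition Hmat :: "real^'n2^'n2 \<Rightarrow> real \<Rightarrow> real \<Rightarrow> real \<Rightarrow>
    real^('n2 + 'l::finite)^('n2 + 'l)" where
  "Hmat D \<gamma> t \<beta> = block ((t * \<beta>) *\<^sub>R D) 0 0 ((1 / (\<gamma> * t * \<beta>)) *\<^sub>R mat 1)"

definition Gmat ::
  "real^'n2^'l \<Rightarrow> real^'n2^'n2 \<Rightarrow> real \<Rightarrow> real \<Rightarrow> real \<Rightarrow> real^('n2 + 'l)^('n2 + 'l)" where
  "Gmat A2 D \<gamma> t \<beta> =
     block ((t * \<beta>) *\<^sub>R (D - \<gamma> *\<^sub>R (transpose A2 ** A2))) (- (1 - \<gamma>) *\<^sub>R transpose A2)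
           (- (1 - \<gamma>) *\<^sub>R A2) (((2 - \<gamma>) / (t * \<beta>)) *\<^sub>R mat 1)"


subsection \<open>The problem\<close>

definition Aop :: "real^'n1^'l \<Rightarrow> real^'n2^'l \<Rightarrow> (real^'n1) \<times> (real^'n2) \<Rightarrow> real^'l" where
  "Aop A1 A2 x = A1 *v fst x + A2 *v snd x"

definition Omega ::
  "real^'n1^'l \<Rightarrow> real^'n2^'l \<Rightarrow> real^'l \<Rightarrow> ((real^'n1) \<times> (real^'n2)) set" where
  "Omega A1 A2 b = {x. Aop A1 A2 x = b}"

definition fsum ::
  "(real^'n1 \<Rightarrow> ereal) \<Rightarrow> (real^'n2 \<Rightarrow> ereal) \<Rightarrow> (real^'n1) \<times> (real^'n2) \<Rightarrow> ereal" where
  "fsum f1 f2 x = f1 (fst x) + f2 (snd x)"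

fun Fop :: "real^'n1^'l \<Rightarrow> real^'n2^'l \<Rightarrow> real^'l \<Rightarrow>
    (real^'n1) \<times> (real^'n2) \<times> (real^'l) \<Rightarrow> (real^'n1) \<times> (real^'n2) \<times> (real^'l)" where
  "Fop A1 A2 b (x1, x2, l) =
     (- (transpose A1 *v l), - (transpose A2 *v l), Aop A1 A2 (x1, x2) - b)"

definition phi :: "real^'n1^'l \<Rightarrow> real^'n2^'l \<Rightarrow> real^'l \<Rightarrow> real \<Rightarrow>
    real^'n1 \<Rightarrow> real^'n2 \<Rightarrow> real^'l \<Rightarrow> real" where
  "phi A1 A2 b \<beta> x1 x2 l =
     - (l \<bullet> (A1 *v x1 + A2 *v x2 - b)) + \<beta> / 2 * (norm (A1 *v x1 + A2 *v x2 - b))\<^sup>2"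


subsection \<open>The algorithm\<close>

text \<open>Sequences are indexed by \<open>int\<close>; only the indices \<open>k \<ge> -1\<close> are meaningful. The iterate
  \<open>x k\<close> is the pair \<open>(x\<^sub>1\<^sup>k, x\<^sub>2\<^sup>k)\<close>. The first definition is
  \<open>x\<^sup>k / \<tau>\<^sup>k\<^sup>-\<^sup>1 - (1 - \<tau>\<^sup>k\<^sup>-\<^sup>1) x\<^sup>k\<^sup>-\<^sup>1 / \<tau>\<^sup>k\<^sup>-\<^sup>1\<close>.\<close>

definition xbar :: "(int \<Rightarrow> real) \<Rightarrow> (int \<Rightarrow> 'a::real_vector) \<Rightarrow> int \<Rightarrow> 'a" where
  "xbar \<tau> x k = (1 / \<tau> (k - 1)) *\<^sub>R x k - ((1 - \<tau> (k - 1)) / \<tau> (k - 1)) *\<^sub>R x (k - 1)"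

definition xhat :: "(int \<Rightarrow> real) \<Rightarrow> (int \<Rightarrow> 'a::real_vector) \<Rightarrow> int \<Rightarrow> 'a" where
  "xhat \<tau> x k = x k + (\<tau> k * (1 - \<tau> (k - 1)) / \<tau> (k - 1)) *\<^sub>R (x k - x (k - 1))"

definition lamhat :: "real^'n1^'l \<Rightarrow> real^'n2^'l \<Rightarrow> real^'l \<Rightarrow> real \<Rightarrow> (int \<Rightarrow> real) \<Rightarrow>
    (int \<Rightarrow> real) \<Rightarrow> (int \<Rightarrow> (real^'n1) \<times> (real^'n2)) \<Rightarrow> (int \<Rightarrow> real^'l) \<Rightarrow> int \<Rightarrow> real^'l" where
  "lamhat A1 A2 b \<gamma> \<beta> \<tau> x lam k =
     lam k + (\<gamma> * (1 - \<tau> k) * \<beta> k) *\<^sub>R (Aop A1 A2 (x k) - b)"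

text \<open>The relation holding between data and sequences generated from arbitrary
  \<open>x (-1)\<close>, \<open>x 0\<close>, \<open>lam 0\<close>. For \<open>\<sigma> = 0\<close> the last term of the second subproblem vanishes.\<close>

definition algorithm2 :: "real^'n1^'l \<Rightarrow> real^'n2^'l \<Rightarrow> real^'l \<Rightarrow>
    (real^'n1 \<Rightarrow> ereal) \<Rightarrow> (real^'n2 \<Rightarrow> ereal) \<Rightarrow> real \<Rightarrow> real^'n2^'n2 \<Rightarrow> real \<Rightarrow>
    (int \<Rightarrow> real) \<Rightarrow> (int \<Rightarrow> real) \<Rightarrow>
    (int \<Rightarrow> (real^'n1) \<times> (real^'n2)) \<Rightarrow> (int \<Rightarrow> real^'l) \<Rightarrow> bool" where
  "algorithm2 A1 A2 b f1 f2 \<sigma> D \<gamma> \<beta> \<tau> x lam \<longleftrightarrow>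
    (\<forall>k\<ge>0.
      (let xh1 = fst (xhat \<tau> x k); xh2 = snd (xhat \<tau> x k);
           lh = lamhat A1 A2 b \<gamma> \<beta> \<tau> x lam k
       in
         is_arg_min
           (\<lambda>y. f1 y + ereal (y \<bullet> grad (\<lambda>w. phi A1 A2 b (\<beta> k) w xh2 lh) xh1
                 + \<beta> k / 2 * qform (transpose A1 ** A1) (y - xh1)))
           (\<lambda>_. True) (fst (x (k + 1)))
       \<and> is_arg_min
           (\<lambda>y. f2 y + ereal (y \<bullet> grad (\<lambda>w. phi A1 A2 b (\<beta> k) (fst (x (k + 1))) w lh) xh2
                 + \<beta> k / 2 * qform D (y - xh2)
                 + \<sigma> * (1 - \<tau> k) / (2 * \<tau> k)
                     * qform ((1 / sigma_max D) *\<^sub>R D) (y - snd (x k))))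
           (\<lambda>_. True) (snd (x (k + 1)))
       \<and> lam (k + 1) = lam k - (\<gamma> * \<tau> k * \<beta> k) *\<^sub>R (Aop A1 A2 (xbar \<tau> x (k + 1)) - b)))"


subsection \<open>Derived sequences\<close>

definition xbreve :: "(int \<Rightarrow> 'a) \<Rightarrow> int \<Rightarrow> 'a" where
  "xbreve x k = x (k + 1)"

definition xtilde :: "(int \<Rightarrow> real) \<Rightarrow> (int \<Rightarrow> 'a::real_vector) \<Rightarrow> int \<Rightarrow> 'a" where
  "xtilde \<tau> x k = xbar \<tau> x (k + 1)"

definition lamtilde :: "real^'n1^'l \<Rightarrow> real^'n2^'l \<Rightarrow> real^'l \<Rightarrow> (int \<Rightarrow> real) \<Rightarrow>
    (int \<Rightarrow> real) \<Rightarrow> (int \<Rightarrow> (real^'n1) \<times> (real^'n2)) \<Rightarrow> (int \<Rightarrow> real^'l) \<Rightarrow> int \<Rightarrow> real^'l" where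
  "lamtilde A1 A2 b \<beta> \<tau> x lam k =
     lam k - (\<tau> k * \<beta> k) *\<^sub>R (A1 *v fst (xtilde \<tau> x k) + A2 *v snd (xbar \<tau> x k) - b)"

definition vseq :: "(int \<Rightarrow> real) \<Rightarrow> (int \<Rightarrow> (real^'n1) \<times> (real^'n2)) \<Rightarrow> (int \<Rightarrow> real^'l) \<Rightarrow>
    int \<Rightarrow> real^('n2 + 'l)" where
  "vseq \<tau> x lam k = stack (snd (xbar \<tau> x k)) (lam k)"

definition vtilde :: "real^'n1^'l \<Rightarrow> real^'n2^'l \<Rightarrow> real^'l \<Rightarrow> (int \<Rightarrow> real) \<Rightarrow> (int \<Rightarrow> real) \<Rightarrow>
    (int \<Rightarrow> (real^'n1) \<times> (real^'n2)) \<Rightarrow> (int \<Rightarrow> real^'l) \<Rightarrow> int \<Rightarrow> real^('n2 + 'l)" where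
  "vtilde A1 A2 b \<beta> \<tau> x lam k =
     stack (snd (xtilde \<tau> x k)) (lamtilde A1 A2 b \<beta> \<tau> x lam k)"

definition utilde :: "real^'n1^'l \<Rightarrow> real^'n2^'l \<Rightarrow> real^'l \<Rightarrow> (int \<Rightarrow> real) \<Rightarrow> (int \<Rightarrow> real) \<Rightarrow>
    (int \<Rightarrow> (real^'n1) \<times> (real^'n2)) \<Rightarrow> (int \<Rightarrow> real^'l) \<Rightarrow> int \<Rightarrow>
    (real^'n1) \<times> (real^'n2) \<times> (real^'l)" where
  "utilde A1 A2 b \<beta> \<tau> x lam k =
     (fst (xtilde \<tau> x k), snd (xtilde \<tau> x k), lamtilde A1 A2 b \<beta> \<tau> x lam k)"

end

theory Submission
  imports Defs
begin

text \<open>Write \<open>z\<close> for the predicted point, so that \<open>x\<^sup>k\<^sup>+\<^sup>1 = \<tau>\<^sup>k z + (1 - \<tau>\<^sup>k) x\<^sup>k\<close>. Optimality in the two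
  subproblems yields subgradients of \<open>f\<^sub>1\<close> and \<open>f\<^sub>2\<close> at \<open>x\<^sup>k\<^sup>+\<^sup>1\<close> of the form \<open>A\<^sub>i\<^sup>T m\<close> up to the proximal
  terms, where \<open>m\<close> is the predicted multiplier minus \<open>(1 - \<gamma>) (1 - \<tau>\<^sup>k) \<beta>\<^sup>k (A x\<^sup>k - b)\<close>. The subgradient
  inequalities at \<open>x\<close> and at \<open>x\<^sup>k\<close>, with weights \<open>\<tau>\<^sup>k\<close> and \<open>1 - \<tau>\<^sup>k\<close>, add up to the variational
  inequality. For the contraction, the form of \<open>G\<^sup>k\<close> at \<open>v\<^sup>k\<close> minus its prediction equals
  \<open>\<tau>\<^sup>k \<beta>\<^sup>k (\<parallel>w\<parallel>\<^sub>D\<^sup>2 + (2 - \<gamma>) \<parallel>\<rho>\<parallel>\<^sup>2 + 2 \<rho>\<^sup>T A\<^sub>2 w)\<close>, with \<open>w\<close> the \<open>x\<^sub>2\<close>-part of that difference and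
  \<open>\<rho> = A z - b\<close>; as \<open>\<parallel>A\<^sub>2 w\<parallel>\<^sup>2 \<le> \<parallel>w\<parallel>\<^sub>D\<^sup>2\<close>, this dominates \<open>(1 - \<gamma>) \<tau>\<^sup>k \<beta>\<^sup>k \<parallel>\<rho>\<parallel>\<^sup>2\<close>, and the partial sums of
  these terms serve as \<open>\<Theta>\<close> (after division by \<open>\<tau>\<^sup>k\<close> in the strongly convex case).\<close>

section \<open>Algebra of block vectors and block matrices\<close>

lemma stack_nth [simp]: "stack y z $ Inl a = y $ a" "stack y z $ Inr c = z $ c"
  by (simp_all add: stack_def)

lemma block_nth [simp]:
  "block P Q R S $ Inl a $ Inl c = P $ a $ c" "block P Q R S $ Inl a $ Inr d = Q $ a $ d"
  "block P Q R S $ Inr e $ Inl c = R $ e $ c" "block P Q R S $ Inr e $ Inr d = S $ e $ d"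
  by (simp_all add: block_def)

lemma sum_UNIV_Plus:
  fixes h :: "'a::finite + 'b::finite \<Rightarrow> 'c::comm_monoid_add"
  shows "sum h UNIV = (\<Sum>a\<in>UNIV. h (Inl a)) + (\<Sum>c\<in>UNIV. h (Inr c))"
  using sum.Plus[of UNIV UNIV h] by simp

lemma all_sum: "(\<forall>i. P i) \<longleftrightarrow> (\<forall>a. P (Inl a)) \<and> (\<forall>c. P (Inr c))"
  by (metis sum.exhaust_sel)

lemma inner_stack: "stack y z \<bullet> stack y' z' = y \<bullet> y' + z \<bullet> z'"
  by (simp add: inner_vec_def sum_UNIV_Plus)

lemma stack_diff: "stack y z - stack y' z' = stack (y - y') (z - z')"
  by (simp add: vec_eq_iff all_sum)

lemma block_mult_stack:
  "block P Q R S *v stack y z = stack (P *v y + Q *v z) (R *v y + S *v z)"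
  by (simp add: vec_eq_iff all_sum matrix_vector_mult_def sum_UNIV_Plus)

lemma block_mult_block:
  "block P Q R S ** block P' Q' R' S'
     = block (P ** P' + Q ** R') (P ** Q' + Q ** S') (R ** P' + S ** R') (R ** Q' + S ** S')"
  by (simp add: vec_eq_iff all_sum matrix_matrix_mult_def sum_UNIV_Plus)

lemma transpose_block:
  "transpose (block P Q R S) = block (transpose P) (transpose R) (transpose Q) (transpose S)"
  by (simp add: vec_eq_iff all_sum transpose_def)

lemma block_add:
  "block P Q R S + block P' Q' R' S' = block (P + P') (Q + Q') (R + R') (S + S')"
  by (simp add: vec_eq_iff all_sum)

lemma block_diff:
  "block P Q R S - block P' Q' R' S' = block (P - P') (Q - Q') (R - R') (S - S')"
  by (simp add: vec_eq_iff all_sum)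

lemma scaleR_block: "c *\<^sub>R block P Q R S = block (c *\<^sub>R P) (c *\<^sub>R Q) (c *\<^sub>R R) (c *\<^sub>R S)"
  by (simp add: vec_eq_iff all_sum)

lemma inner_transpose_mult:
  fixes A :: "real^'n^'m"
  shows "(transpose A *v l) \<bullet> y = l \<bullet> (A *v y)"
  by (simp add: dot_lmul_matrix transpose_matrix_vector)

lemma inner_vector_matrix_mult:
  fixes A :: "real^'n^'m"
  shows "y \<bullet> (l v* A) = l \<bullet> (A *v y)"
  by (metis dot_lmul_matrix inner_commute)

lemma qform_scaleR: "qform (c *\<^sub>R D) w = c * qform D w"
  by (simp add: qform_def scaleR_matrix_vector_assoc[symmetric])

lemma transpose_uminus: "transpose (- A) = - transpose A" for A :: "real^'n^'m"
  by (simp add: vec_eq_iff transpose_def)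

lemma transpose_zero: "transpose 0 = (0 :: real^'n^'m)"
  by (simp add: vec_eq_iff transpose_def)

lemma matrix_mult_uminus_left: "- A ** B = - (A ** B)" for A :: "real^'n^'m" and B :: "real^'p^'n"
  using scalar_matrix_assoc[of "-1" A B] by (simp only: scaleR_minus1_left)

lemma matrix_mult_uminus_right: "A ** - B = - (A ** B)" for A :: "real^'n^'m" and B :: "real^'p^'n"
  using matrix_scalar_ac[of A "-1" B] by (simp add: matrix_mult_uminus_left)

lemma Qmat_eq:
  assumes "\<gamma> \<noteq> 0" "t * \<beta> \<noteq> 0"
  shows "Qmat A2 D t \<beta> = Hmat D \<gamma> t \<beta> ** Mmat A2 \<gamma> t \<beta>"
  using assms
  by (simp add: Qmat_def Hmat_def Mmat_def block_mult_block matrix_scalar_ac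
      scalar_matrix_assoc[symmetric] matrix_mult_uminus_right)

text \<open>The product of \<open>Hmat\<close> and \<open>Mmat\<close> is \<open>Qmat\<close>, so
  the triple product collapses to the transpose of \<open>Mmat\<close> times \<open>Qmat\<close>.
  Symmetry of \<open>D\<close> makes the upper left blocks of \<open>Qmat\<close> and its transpose
  agree.\<close>

lemma Gmat_eq:
  assumes "\<gamma> \<noteq> 0" "t * \<beta> \<noteq> 0" "transpose D = D"
  shows "Gmat A2 D \<gamma> t \<beta> = transpose (Qmat A2 D t \<beta>) + Qmat A2 D t \<beta>
    - transpose (Mmat A2 \<gamma> t \<beta>) ** Hmat D \<gamma> t \<beta> ** Mmat A2 \<gamma> t \<beta>"
  unfolding matrix_mul_assoc[symmetric] Qmat_eq[OF assms(1,2), symmetric]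
  using assms
  by (simp add: Qmat_def Gmat_def Mmat_def transpose_block block_mult_block block_add block_diff
      transpose_scalar transpose_uminus matrix_scalar_ac scalar_matrix_assoc[symmetric]
      matrix_mult_uminus_left matrix_mult_uminus_right transpose_zero
      diff_divide_distrib scaleR_left.diff)
    (simp add: vec_eq_iff all_sum field_simps)

section \<open>Largest eigenvalue of a symmetric matrix\<close>

lemma symmetric_inner_commute:
  fixes D :: "real^'n^'n"
  assumes "transpose D = D"
  shows "(D *v y) \<bullet> z = y \<bullet> (D *v z)"
  using inner_transpose_mult[of D y z] assms by simp

text \<open>Eigenvectors of distinct eigenvalues are orthogonal, so choosing one for each eigenvalue
  gives an injective, linearly independent family. Finiteness is what makes \<open>Max\<close> in
  \<open>sigma_max\<close> an upper bound.\<close>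

lemma finite_eigenvalues_symmetric:
  fixes D :: "real^'n^'n"
  assumes D: "transpose D = D"
  shows "finite {\<mu>. \<exists>w. w \<noteq> 0 \<and> D *v w = \<mu> *\<^sub>R w}" (is "finite ?E")
proof -
  define e where "e \<mu> = (SOME w. w \<noteq> 0 \<and> D *v w = \<mu> *\<^sub>R w)" for \<mu>
  have e: "e \<mu> \<noteq> 0" "D *v e \<mu> = \<mu> *\<^sub>R e \<mu>" if "\<mu> \<in> ?E" for \<mu>
    using someI_ex[of "\<lambda>w. w \<noteq> 0 \<and> D *v w = \<mu> *\<^sub>R w"] that unfolding e_def by blast+
  have orth: "e \<mu> \<bullet> e \<nu> = 0" if "\<mu> \<in> ?E" "\<nu> \<in> ?E" "\<mu> \<noteq> \<nu>" for \<mu> \<nu>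
    using symmetric_inner_commute[OF D, of "e \<mu>" "e \<nu>"] e(2)[OF that(1)] e(2)[OF that(2)] that(3)
    by simp
  have inj: "inj_on e ?E"
    using orth e(1) by (metis (no_types, lifting) inj_onI inner_eq_zero_iff)
  have "pairwise orthogonal (e ` ?E)"
    unfolding pairwise_def orthogonal_def using orth by blast
  moreover have "0 \<notin> e ` ?E" using e(1) by force
  ultimately have "finite (e ` ?E)"
    using pairwise_orthogonal_independent independent_imp_finite by blast
  then show ?thesis using inj finite_image_iff by blast
qed

text \<open>Rayleigh quotient argument: the form attains its maximum \<open>m\<close> over the unit
  sphere at some \<open>e\<close>, and \<open>e\<close> turns out to be an eigenvector, so
  \<open>m\<close> is at most \<open>sigma_max D\<close>.\<close>

lemma qform_le_sigma_max:
  fixes D :: "real^'n^'n"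
  assumes D: "transpose D = D"
  shows "qform D w \<le> sigma_max D * (norm w)\<^sup>2"
proof -
  have "continuous_on (sphere 0 1) (qform D)"
    unfolding qform_def by (intro continuous_intros matrix_vector_mult_linear_continuous_on)
  moreover have "sphere (0::real^'n) 1 \<noteq> {}" by simp
  ultimately obtain e where e: "norm e = 1" and mx: "\<And>y. norm y = 1 \<Longrightarrow> qform D y \<le> qform D e"
    using continuous_attains_sup[of "sphere (0::real^'n) 1" "qform D"] by auto
  define m where "m = qform D e"
  have le: "qform D y \<le> m * (norm y)\<^sup>2" for y
  proof (cases "y = 0")
    case True then show ?thesis by (simp add: qform_def)
  next
    case False
    have "qform D (inverse (norm y) *\<^sub>R y) \<le> m" unfolding m_def by (rule mx) (simp add: False)
    then show ?thesis
      using False by (simp add: qform_def matrix_vector_mult_scaleR field_simps power2_eq_square)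
  qed
  define z where "z = m *\<^sub>R e - D *v e"
  define p where "p = m * (norm z)\<^sup>2 - qform D z"
  \<comment> \<open>The gap in \<open>le\<close> is nonnegative and vanishes at \<open>e\<close>.
    Along \<open>e + s *\<^sub>R z\<close> it is this parabola in \<open>s\<close>, which can stay
    nonnegative only if its linear coefficient vanishes.\<close>
  have quad: "2 * s * (z \<bullet> z) + s\<^sup>2 * p \<ge> 0" for s
  proof -
    have "m * (norm (e + s *\<^sub>R z))\<^sup>2 - qform D (e + s *\<^sub>R z)
       = m * (e \<bullet> e) - qform D e + 2 * s * (z \<bullet> (m *\<^sub>R e - D *v e)) + s\<^sup>2 * p"
      using symmetric_inner_commute[OF D, of e z]
      unfolding p_def power2_norm_eq_inner
      by (simp add: qform_def matrix_vector_right_distrib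
          matrix_vector_mult_scaleR algebra_simps inner_commute power2_eq_square)
    also have "m * (e \<bullet> e) = qform D e" using e by (simp add: m_def norm_eq_1)
    finally show ?thesis using le[of "e + s *\<^sub>R z"] by (simp add: z_def[symmetric])
  qed
  have "p \<ge> 0" using le[of z] by (simp add: p_def)
  have "z \<bullet> z \<le> 0"
  proof (cases "p = 0")
    case True then show ?thesis using quad[of "-1"] by simp
  next
    case False
    \<comment> \<open>The substituted \<open>s\<close> is the minimizer of the parabola.\<close>
    have "2 * (- (z \<bullet> z) / p) * (z \<bullet> z) + (- (z \<bullet> z) / p)\<^sup>2 * p = - ((z \<bullet> z)\<^sup>2 / p)"
      using False by (simp add: power2_eq_square field_simps)
    then have "(z \<bullet> z)\<^sup>2 / p \<le> 0" using quad[of "- (z \<bullet> z) / p"] by simp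
    then show ?thesis using \<open>p \<ge> 0\<close> False by (simp add: divide_le_0_iff)
  qed
  then have "z = 0" by (metis inner_gt_zero_iff not_less)
  then have "D *v e = m *\<^sub>R e" by (simp add: z_def)
  moreover have "e \<noteq> 0" using e by auto
  ultimately have "m \<le> sigma_max D"
    unfolding sigma_max_def by (intro Max_ge finite_eigenvalues_symmetric D) auto
  then have "m * (norm w)\<^sup>2 \<le> sigma_max D * (norm w)\<^sup>2" by (intro mult_right_mono) auto
  then show ?thesis using le[of w] by linarith
qed

section \<open>Gradients of the smooth terms in the subproblems\<close>

lemma grad_eqI: "GDERIV h x :> g \<Longrightarrow> grad h x = g"
proof -
  assume g: "GDERIV h x :> g"
  \<comment> \<open>Uniqueness is what lets the definite description in \<open>grad\<close> be
    evaluated.\<close>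
  have "g' = g" if "GDERIV h x :> g'" for g'
    using has_derivative_unique[OF g[unfolded gderiv_def] that[unfolded gderiv_def]]
    by (metis (no_types) inner_commute vector_eq_rdot)
  then show ?thesis unfolding grad_def using g by blast
qed

lemma GDERIV_phi1:
  "GDERIV (\<lambda>w. phi A1 A2 b \<beta> w x2 l) x1 :> transpose A1 *v (\<beta> *\<^sub>R (A1 *v x1 + A2 *v x2 - b) - l)"
  unfolding gderiv_def phi_def power2_norm_eq_inner
  apply (rule derivative_eq_intros refl
     bounded_linear.has_derivative[OF matrix_vector_mul_bounded_linear] | simp)+
  by (simp add: fun_eq_iff inner_vector_matrix_mult
      inner_add_left inner_add_right inner_diff_left inner_diff_right inner_commute field_simps)

text \<open>\<open>phi\<close> is unchanged when the two blocks trade places.\<close>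

lemma GDERIV_phi2:
  "GDERIV (\<lambda>w. phi A1 A2 b \<beta> x1 w l) x2 :> transpose A2 *v (\<beta> *\<^sub>R (A1 *v x1 + A2 *v x2 - b) - l)"
  using GDERIV_phi1[of A2 A1 b \<beta> x1 l x2] by (simp add: phi_def add.commute)

lemma GDERIV_qform:
  assumes "transpose D = D"
  shows "GDERIV (\<lambda>y. c * qform D (y - a)) y :> (2 * c) *\<^sub>R (D *v (y - a))"
  unfolding gderiv_def qform_def
  apply (rule derivative_eq_intros refl
     bounded_linear.has_derivative[OF matrix_vector_mul_bounded_linear] | simp)+
  using symmetric_inner_commute[OF assms]
  by (simp add: fun_eq_iff algebra_simps inner_commute)

lemma GDERIV_inner_left: "GDERIV (\<lambda>y. y \<bullet> g) y :> g"
  unfolding gderiv_def by (auto intro!: derivative_eq_intros)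

section \<open>First-order optimality for extended-valued convex functions\<close>

lemma eepigraph_convex_combination:
  assumes "convex (eepigraph f)" "f x = ereal r" "f y = ereal s" "0 \<le> t" "t \<le> 1"
  shows "f (x + t *\<^sub>R (y - x)) \<le> ereal (r + t * (s - r))"
proof -
  have "(1 - t) *\<^sub>R (x, r) + t *\<^sub>R (y, s) \<in> eepigraph f"
    using assms by (intro convexD_alt) (auto simp: eepigraph_def)
  then show ?thesis by (simp add: eepigraph_def algebra_simps)
qed

text \<open>Properness supplies a competitor with a finite value, and \<open>q\<close> is
  real-valued, so the value at the minimizer is below \<open>\<infinity>\<close>; properness also
  excludes \<open>-\<infinity>\<close>.\<close>

lemma is_arg_min_finite:
  fixes q :: "'a::euclidean_space \<Rightarrow> real"
  assumes f: "closed_proper_convex f"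
    and min: "is_arg_min (\<lambda>y. f y + ereal (q y)) (\<lambda>_. True) x"
  obtains r where "f x = ereal r"
proof -
  obtain y where "f y \<noteq> \<infinity>" using f by (auto simp: closed_proper_convex_def)
  moreover have "f x + ereal (q x) \<le> f y + ereal (q y)" using min by (auto simp: is_arg_min_linorder)
  ultimately have "f x \<noteq> \<infinity>" by (cases "f y") auto
  moreover have "f x \<noteq> - \<infinity>" using f by (auto simp: closed_proper_convex_def)
  ultimately show ?thesis using that by (cases "f x") auto
qed

text \<open>On the segment from \<open>x\<close> to \<open>y\<close> the function \<open>f\<close>
  lies below its chord. Hence the chord plus \<open>q\<close>, which up to a constant is
  \<open>h\<close>, is minimal at the left end and has a nonnegative derivative there.\<close>

lemma subdiff_of_arg_min:
  fixes q :: "'a::euclidean_space \<Rightarrow> real"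
  assumes f: "closed_proper_convex f"
    and min: "is_arg_min (\<lambda>y. f y + ereal (q y)) (\<lambda>_. True) x"
    and q: "GDERIV q x :> g"
  shows "- g \<in> subdiff f x"
proof -
  obtain r where r: "f x = ereal r" using is_arg_min_finite[OF f min] .
  have "f y \<ge> f x + ereal (- g \<bullet> (y - x))" for y
  proof (cases "f y")
    case (real s)
    define h where "h t = t * (s - r) + q (x + t *\<^sub>R (y - x))" for t
    have "((\<lambda>t. q (x + t *\<^sub>R (y - x))) has_derivative (\<lambda>t. (t *\<^sub>R (y - x)) \<bullet> g)) (at 0)"
    proof (rule has_derivative_compose[of "\<lambda>t. x + t *\<^sub>R (y - x)" "\<lambda>t. t *\<^sub>R (y - x)" 0 UNIV q])
      show "(q has_derivative (\<lambda>h. h \<bullet> g)) (at (x + 0 *\<^sub>R (y - x)))" using q by (simp add: gderiv_def)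
    qed (auto intro!: derivative_eq_intros)
    then have "((\<lambda>t. q (x + t *\<^sub>R (y - x))) has_real_derivative (y - x) \<bullet> g) (at 0)"
      unfolding has_field_derivative_def by (simp add: mult_commute_abs)
    then have dh: "(h has_real_derivative s - r + (y - x) \<bullet> g) (at 0)"
      unfolding h_def by (auto intro!: derivative_eq_intros)
    have h0: "h 0 \<le> h t" if "0 < t" "t < 1" for t
    proof -
      have "f x + ereal (q x) \<le> f (x + t *\<^sub>R (y - x)) + ereal (q (x + t *\<^sub>R (y - x)))"
        using min by (auto simp: is_arg_min_linorder)
      also have "\<dots> \<le> ereal (r + t * (s - r)) + ereal (q (x + t *\<^sub>R (y - x)))"
        using f r real that
        by (intro add_right_mono eepigraph_convex_combination) (auto simp: closed_proper_convex_def)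
      finally show ?thesis by (simp add: h_def r)
    qed
    have "s - r + (y - x) \<bullet> g \<ge> 0"
    proof (rule ccontr)
      assume "\<not> ?thesis"
      then obtain d where d: "d > 0" "\<And>u. 0 < u \<Longrightarrow> u < d \<Longrightarrow> h (0 + u) < h 0"
        using DERIV_neg_dec_right[OF dh] by auto
      \<comment> \<open>Halving keeps \<open>u\<close> below both \<open>d\<close> and 1, where the
        two bounds on \<open>h\<close> contradict each other.\<close>
      define u where "u = min (d / 2) (1 / 2)"
      have "0 < u" "u < d" "u < 1" using d(1) by (auto simp: u_def)
      then show False using d(2)[of u] h0[of u] by simp
    qed
    then show ?thesis by (simp add: r real inner_commute)
  qed (use f in \<open>auto simp: closed_proper_convex_def\<close>)
  then show ?thesis by (simp add: subdiff_def)
qed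

section \<open>Quadratic forms of \<open>Hmat\<close> and \<open>Gmat\<close>, and the action of
  \<open>Qmat\<close>\<close>

lemma uminus_matrix_vector_mult: "- A *v x = - (A *v x)" for A :: "real^'n^'m"
  by (simp add: vec_eq_iff matrix_vector_mult_def sum_negf)

lemma qform_Hmat:
  "qform (Hmat D \<gamma> t \<beta>) (stack y z) = t * \<beta> * qform D y + 1 / (\<gamma> * t * \<beta>) * (norm z)\<^sup>2"
  by (simp add: qform_def Hmat_def block_mult_stack inner_stack power2_norm_eq_inner
      scaleR_matrix_vector_assoc[symmetric])

lemma qform_Gmat_ge:
  fixes A2 :: "real^'n^'l"
  assumes tb: "t * \<beta> > 0" and D: "(norm (A2 *v w))\<^sup>2 \<le> qform D w"
  shows "qform (Gmat A2 D \<gamma> t \<beta>) (stack w ((t * \<beta>) *\<^sub>R (\<rho> + A2 *v w)))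
    \<ge> (1 - \<gamma>) * t * \<beta> * (norm \<rho>)\<^sup>2"
proof -
  define s where "s = t * \<beta>"
  have s: "s > 0" using tb by (simp add: s_def)
  have "transpose A2 ** A2 *v w = transpose A2 *v (A2 *v w)"
    by (simp only: matrix_vector_mul_assoc)
  then have "qform (Gmat A2 D \<gamma> t \<beta>) (stack w (s *\<^sub>R (\<rho> + A2 *v w)))
      = s * (qform D w + (2 - \<gamma>) * (norm \<rho>)\<^sup>2 + 2 * (\<rho> \<bullet> (A2 *v w)))"
    using s unfolding Gmat_def s_def[symmetric] power2_norm_eq_inner
    by (simp add: qform_def block_mult_stack inner_stack inner_vector_matrix_mult
        scaleR_matrix_vector_assoc[symmetric] matrix_vector_mult_diff_rdistrib
        inner_commute inner_add_left inner_add_right inner_diff_left inner_diff_right field_simps)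
  \<comment> \<open>Completing the square: by the bound on \<open>D\<close>, the excess over
    \<open>(1 - \<gamma>) * (norm \<rho>)\<^sup>2\<close> is at least this square.\<close>
  moreover have "(norm (\<rho> + A2 *v w))\<^sup>2 = (norm \<rho>)\<^sup>2 + 2 * (\<rho> \<bullet> (A2 *v w)) + (norm (A2 *v w))\<^sup>2"
    by (simp add: power2_norm_eq_inner inner_commute algebra_simps)
  then have "qform D w + (2 - \<gamma>) * (norm \<rho>)\<^sup>2 + 2 * (\<rho> \<bullet> (A2 *v w)) \<ge> (1 - \<gamma>) * (norm \<rho>)\<^sup>2"
    using D zero_le_power2[of "norm (\<rho> + A2 *v w)"] by (simp add: algebra_simps)
  then have "s * (qform D w + (2 - \<gamma>) * (norm \<rho>)\<^sup>2 + 2 * (\<rho> \<bullet> (A2 *v w))) \<ge> s * ((1 - \<gamma>) * (norm \<rho>)\<^sup>2)"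
    using s by (intro mult_left_mono) auto
  ultimately show ?thesis by (simp add: s_def mult_ac)
qed

text \<open>The multiplier component of \<open>Qmat\<close> times the difference is the residual at
  the predicted point, because \<open>lt\<close> contains \<open>A2 *v xb2\<close> and the block
  \<open>- A2\<close> trades it for \<open>A2 *v xt2\<close>. It cancels against the last component
  of \<open>Fop\<close>, so the free \<open>l\<close> disappears.\<close>

lemma Qmat_Fop_identity:
  fixes A1 :: "real^'n1^'l" and A2 :: "real^'n2^'l"
  assumes tb: "t * \<beta> \<noteq> 0" and lt: "lt = lk - (t * \<beta>) *\<^sub>R (A1 *v xt1 + A2 *v xb2 - b)"
  shows "(stack y2 l - stack xt2 lt) \<bullet> (Qmat A2 D t \<beta> *v (stack xb2 lk - stack xt2 lt))
      - ((y1, y2, l) - (xt1, xt2, lt)) \<bullet> Fop A1 A2 b (xt1, xt2, lt)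
    = lt \<bullet> Aop A1 A2 ((y1, y2) - (xt1, xt2)) - t * \<beta> * ((D *v (xt2 - xb2)) \<bullet> (y2 - xt2))"
proof -
  define s where "s = t * \<beta>"
  have "(1 / s) *\<^sub>R (lk - lt) = A1 *v xt1 + A2 *v xb2 - b" using tb by (simp add: lt s_def)
  then have "(1 / s) *\<^sub>R lk - (1 / s) *\<^sub>R lt = A1 *v xt1 + A2 *v xb2 - b"
    by (simp only: scaleR_diff_right)
  then have "Qmat A2 D t \<beta> *v (stack xb2 lk - stack xt2 lt)
     = stack (s *\<^sub>R (D *v (xb2 - xt2))) (A1 *v xt1 + A2 *v xt2 - b)"
    unfolding Qmat_def s_def[symmetric] stack_diff block_mult_stack
    by (simp add: scaleR_matrix_vector_assoc[symmetric] matrix_vector_mult_diff_distrib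
        uminus_matrix_vector_mult scaleR_diff_right add_ac add_diff_eq diff_add_eq)
  then show ?thesis unfolding stack_diff s_def[symmetric]
    by (simp add: inner_stack inner_prod_def Aop_def inner_vector_matrix_mult inner_commute
        matrix_vector_mult_diff_distrib algebra_simps)
qed

section \<open>Weighted subgradient inequalities\<close>

lemma subdiff_convex_combination:
  assumes sc: "strongly_convex \<sigma> f" and g: "g \<in> subdiff f p"
    and t: "0 \<le> t" "t \<le> 1" and p: "p = t *\<^sub>R z + (1 - t) *\<^sub>R q"
    and f: "f y = ereal a" "f q = ereal c" "f p = ereal r"
  shows "t * a + (1 - t) * c - r
    \<ge> t * (g \<bullet> (y - z)) + \<sigma> / 2 * (t * (norm (y - p))\<^sup>2 + (1 - t) * (norm (q - p))\<^sup>2)"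
proof -
  have "a \<ge> r + (g \<bullet> (y - p) + \<sigma> / 2 * (norm (y - p))\<^sup>2)"
    "c \<ge> r + (g \<bullet> (q - p) + \<sigma> / 2 * (norm (q - p))\<^sup>2)"
    using sc g f unfolding strongly_convex_def by (metis ereal_less_eq(3) plus_ereal.simps(1))+
  then have le: "t * a \<ge> t * (r + (g \<bullet> (y - p) + \<sigma> / 2 * (norm (y - p))\<^sup>2))"
    "(1 - t) * c \<ge> (1 - t) * (r + (g \<bullet> (q - p) + \<sigma> / 2 * (norm (q - p))\<^sup>2))"
    using t by (auto intro: mult_left_mono)
  \<comment> \<open>The two linear terms merge: the weighted test points minus \<open>p\<close>
    equal \<open>t *\<^sub>R (y - z)\<close>, so the extrapolated point \<open>z\<close> takes the
    place of \<open>p\<close>.\<close>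
  have "t * (g \<bullet> (y - p)) + (1 - t) * (g \<bullet> (q - p)) = g \<bullet> (t *\<^sub>R y + (1 - t) *\<^sub>R q - p)"
    by (simp add: algebra_simps)
  moreover have "t *\<^sub>R y + (1 - t) *\<^sub>R q - p = t *\<^sub>R (y - z)" by (simp add: p algebra_simps)
  ultimately have g: "t * (g \<bullet> (y - p)) + (1 - t) * (g \<bullet> (q - p)) = t * (g \<bullet> (y - z))" by simp
  have "t * (r + (e + \<sigma> / 2 * n)) + (1 - t) * (r + (e' + \<sigma> / 2 * n'))
      = r + (t * e + (1 - t) * e') + \<sigma> / 2 * (t * n + (1 - t) * n')" for e e' n n'
    by (simp add: field_simps)
  from add_mono[OF le, unfolded this g] show ?thesis by linarith
qed

text \<open>Lets \<open>f1\<close> use the same weighted inequality as \<open>f2\<close>.\<close>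

lemma strongly_convex_zero: "strongly_convex 0 f"
  by (auto simp: strongly_convex_def subdiff_def)

text \<open>The proximal term with modulus \<open>\<sigma> (1 - t) / t\<close> centred at \<open>q\<close> moves the strong
  convexity from \<open>p\<close> to the extrapolated point \<open>z\<close>.\<close>

lemma strong_convexity_shift:
  fixes R :: "real^'n^'n"
  assumes t: "0 < t" "t \<le> 1" and p: "p = t *\<^sub>R z + (1 - t) *\<^sub>R q"
    and R: "transpose R = R" "\<And>w. 0 \<le> qform R w" "\<And>w. qform R w \<le> (norm w)\<^sup>2"
  shows "t * (norm (y - p))\<^sup>2 + (1 - t) * (norm (q - p))\<^sup>2
    \<ge> t * qform R (z - y) + 2 * (1 - t) * ((R *v (p - q)) \<bullet> (y - z))"
proof -
  define d where "d = z - q"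
  define a where "a = z - y"
  have "z - q = d" "p - q = t *\<^sub>R d" "y - p = (1 - t) *\<^sub>R d - a" "y - z = - a" "q - p = - (t *\<^sub>R d)"
    by (simp_all add: d_def a_def p algebra_simps)
  note eqs = this
  have 1: "qform R ((1 - t) *\<^sub>R d - a) = (1 - t)\<^sup>2 * qform R d - 2 * (1 - t) * ((R *v d) \<bullet> a) + qform R a"
    using symmetric_inner_commute[OF R(1), of d a]
    by (simp add: qform_def matrix_vector_mult_diff_distrib matrix_vector_mult_scaleR
        inner_diff_left inner_diff_right inner_commute power2_eq_square algebra_simps)
  have 2: "qform R (- (t *\<^sub>R d)) = t\<^sup>2 * qform R d"
    by (simp add: qform_def matrix_vector_mult_scaleR power2_eq_square linear_neg[OF matrix_vector_mul_linear])
  \<comment> \<open>With the norms replaced by the form of \<open>R\<close>, the two sides of the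
    claim differ exactly by \<open>t * (1 - t) * qform R d\<close>.\<close>
  have "t * qform R (y - p) + (1 - t) * qform R (q - p)
      = t * qform R a - 2 * (1 - t) * t * ((R *v d) \<bullet> a) + t * (1 - t) * qform R d"
    unfolding eqs 1 2 by (simp add: algebra_simps power2_eq_square)
  moreover have "(R *v (p - q)) \<bullet> (y - z) = - t * ((R *v d) \<bullet> a)"
    unfolding eqs by (simp add: matrix_vector_mult_scaleR)
  moreover have "t * (norm (y - p))\<^sup>2 + (1 - t) * (norm (q - p))\<^sup>2
     \<ge> t * qform R (y - p) + (1 - t) * qform R (q - p)"
    using t R(3) by (intro add_mono mult_left_mono) auto
  moreover have "t * (1 - t) * qform R d \<ge> 0" using t R(2) by simp
  ultimately show ?thesis unfolding a_def[symmetric] by simp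
qed

text \<open>Both subgradients contain the same \<open>m\<close>, so the blocks add up to a single
  term in \<open>Aop\<close>. The \<open>R\<close> part of the second subgradient comes from the
  extra proximal term and is absorbed by \<open>strong_convexity_shift\<close>.\<close>

lemma subdiff_pair_convex_combination:
  fixes A1 :: "real^'n1^'l" and A2 :: "real^'n2^'l"
  assumes f: "closed_proper_convex f1" "closed_proper_convex f2"
    and \<sigma>: "0 \<le> \<sigma>" "strongly_convex \<sigma> f2"
    and t: "0 < t" "t \<le> 1"
    and p: "(p1, p2) = t *\<^sub>R (z1, z2) + (1 - t) *\<^sub>R (q1, q2)"
    and R: "transpose R = R" "\<And>w. 0 \<le> qform R w" "\<And>w. qform R w \<le> (norm w)\<^sup>2"
    and g1: "transpose A1 *v m \<in> subdiff f1 p1"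
    and g2: "transpose A2 *v m - d - (\<sigma> * (1 - t) / t) *\<^sub>R (R *v (p2 - q2)) \<in> subdiff f2 p2"
    and vals: "fsum f1 f2 (y1, y2) = ereal a" "fsum f1 f2 (q1, q2) = ereal c" "fsum f1 f2 (p1, p2) = ereal r"
  shows "t * a + (1 - t) * c - r
    \<ge> t * (m \<bullet> Aop A1 A2 ((y1, y2) - (z1, z2)) - d \<bullet> (y2 - z2) + \<sigma> / 2 * qform R (z2 - y2))"
proof -
  have split: "\<exists>u1 u2. f1 w1 = ereal u1 \<and> f2 w2 = ereal u2 \<and> u = u1 + u2"
    if "fsum f1 f2 (w1, w2) = ereal u" for w1 w2 u
    using that f by (cases "f1 w1"; cases "f2 w2") (auto simp: fsum_def closed_proper_convex_def)
  obtain a1 a2 c1 c2 r1 r2 where v: "f1 y1 = ereal a1" "f2 y2 = ereal a2" "f1 q1 = ereal c1"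
    "f2 q2 = ereal c2" "f1 p1 = ereal r1" "f2 p2 = ereal r2" and acr: "a = a1 + a2" "c = c1 + c2" "r = r1 + r2"
    using split[OF vals(1)] split[OF vals(2)] split[OF vals(3)] by metis
  have p1: "p1 = t *\<^sub>R z1 + (1 - t) *\<^sub>R q1" and p2: "p2 = t *\<^sub>R z2 + (1 - t) *\<^sub>R q2" using p by auto
  have "t * a1 + (1 - t) * c1 - r1 \<ge> t * ((transpose A1 *v m) \<bullet> (y1 - z1))"
    using subdiff_convex_combination[OF strongly_convex_zero g1 _ t(2) p1 v(1,3,5)] t by simp
  then have le1: "t * a1 + (1 - t) * c1 - r1 \<ge> t * (m \<bullet> (A1 *v (y1 - z1)))"
    by (simp only: inner_transpose_mult)
  have le2: "t * a2 + (1 - t) * c2 - r2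
    \<ge> t * (m \<bullet> (A2 *v (y2 - z2)) - d \<bullet> (y2 - z2))
      - \<sigma> * (1 - t) * ((R *v (p2 - q2)) \<bullet> (y2 - z2))
      + \<sigma> / 2 * (t * (norm (y2 - p2))\<^sup>2 + (1 - t) * (norm (q2 - p2))\<^sup>2)"
    using subdiff_convex_combination[OF \<sigma>(2) g2 _ t(2) p2 v(2,4,6)] t
    by (simp only: inner_diff_left inner_scaleR_left inner_transpose_mult) (simp add: right_diff_distrib)
  have "\<sigma> / 2 * (t * qform R (z2 - y2) + 2 * (1 - t) * ((R *v (p2 - q2)) \<bullet> (y2 - z2)))
     \<le> \<sigma> / 2 * (t * (norm (y2 - p2))\<^sup>2 + (1 - t) * (norm (q2 - p2))\<^sup>2)"
    using \<sigma>(1) by (intro mult_left_mono strong_convexity_shift[OF t p2 R]) auto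
  then have le3: "t * (\<sigma> / 2 * qform R (z2 - y2)) + \<sigma> * (1 - t) * ((R *v (p2 - q2)) \<bullet> (y2 - z2))
     \<le> \<sigma> / 2 * (t * (norm (y2 - p2))\<^sup>2 + (1 - t) * (norm (q2 - p2))\<^sup>2)"
    by (simp add: field_simps)
  have "m \<bullet> Aop A1 A2 ((y1, y2) - (z1, z2)) = m \<bullet> (A1 *v (y1 - z1)) + m \<bullet> (A2 *v (y2 - z2))"
    by (simp add: Aop_def inner_add_right)
  then have "t * (m \<bullet> Aop A1 A2 ((y1, y2) - (z1, z2)) - d \<bullet> (y2 - z2) + \<sigma> / 2 * qform R (z2 - y2))
    = t * (m \<bullet> (A1 *v (y1 - z1))) + t * (m \<bullet> (A2 *v (y2 - z2)) - d \<bullet> (y2 - z2))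
      + t * (\<sigma> / 2 * qform R (z2 - y2))"
    by (simp only: distrib_left right_diff_distrib)
  moreover have "t * a + (1 - t) * c - r = (t * a1 + (1 - t) * c1 - r1) + (t * a2 + (1 - t) * c2 - r2)"
    by (simp add: acr algebra_simps)
  ultimately show ?thesis using le1 le2 le3 by linarith
qed

section \<open>One iteration of the algorithm\<close>

lemma x_Suc_eq:
  assumes "\<tau> k \<noteq> 0"
  shows "x (k + 1) = \<tau> k *\<^sub>R xtilde \<tau> x k + (1 - \<tau> k) *\<^sub>R x k"
  using assms by (simp add: xtilde_def xbar_def scaleR_diff_right)

text \<open>This is the combination of \<open>x_Suc_eq\<close> with \<open>xbar\<close> in place of
  the predicted point, so \<open>x (k + 1) - xhat \<tau> x k\<close> is \<open>\<tau> k\<close>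
  times the difference of those two points.\<close>

lemma xhat_eq:
  assumes "\<tau> (k - 1) \<noteq> 0"
  shows "xhat \<tau> x k = \<tau> k *\<^sub>R xbar \<tau> x k + (1 - \<tau> k) *\<^sub>R x k"
proof -
  define s where "s = \<tau> (k - 1)"
  have s: "(1 - s) / s = 1 / s - 1" using assms by (simp add: s_def diff_divide_distrib)
  have ts: "\<tau> k * (1 - s) / s = \<tau> k * (1 / s - 1)" using s by (metis times_divide_eq_right)
  define u where "u = 1 / s"
  show ?thesis unfolding xhat_def xbar_def s_def[symmetric] s ts u_def[symmetric]
    by (simp add: algebra_simps)
qed

text \<open>Both subproblems see the residual \<open>e\<close> at the mixed point made of the new
  first block and the extrapolated second block, hence share the multiplier
  \<open>m\<close>.\<close>

lemma algorithm2_optimality: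
  fixes A1 :: "real^'n1^'l" and A2 :: "real^'n2^'l"
  assumes f: "closed_proper_convex f1" "closed_proper_convex f2"
    and alg: "algorithm2 A1 A2 b f1 f2 \<sigma> D \<gamma> \<beta>s \<tau> x lam"
    and k: "0 \<le> k" "\<tau> k \<noteq> 0" "\<tau> (k - 1) \<noteq> 0"
    and D: "transpose D = D"
  defines "R \<equiv> (1 / sigma_max D) *\<^sub>R D"
    and "m \<equiv> lamtilde A1 A2 b \<beta>s \<tau> x lam k - ((1 - \<gamma>) * (1 - \<tau> k) * \<beta>s k) *\<^sub>R (Aop A1 A2 (x k) - b)"
  shows "transpose A1 *v m \<in> subdiff f1 (fst (x (k + 1)))"
    and "transpose A2 *v m - (\<tau> k * \<beta>s k) *\<^sub>R (D *v (snd (xtilde \<tau> x k) - snd (xbar \<tau> x k)))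
      - (\<sigma> * (1 - \<tau> k) / \<tau> k) *\<^sub>R (R *v (snd (x (k + 1)) - snd (x k))) \<in> subdiff f2 (snd (x (k + 1)))"
    and "\<exists>r. fsum f1 f2 (x (k + 1)) = ereal r"
proof -
  define t \<beta> where "t = \<tau> k" and "\<beta> = \<beta>s k"
  define xh1 xh2 lh where "xh1 = fst (xhat \<tau> x k)" and "xh2 = snd (xhat \<tau> x k)"
    and "lh = lamhat A1 A2 b \<gamma> \<beta>s \<tau> x lam k"
  define p1 p2 where "p1 = fst (x (k + 1))" and "p2 = snd (x (k + 1))"
  define q1 where "q1 y = y \<bullet> grad (\<lambda>w. phi A1 A2 b \<beta> w xh2 lh) xh1
     + \<beta> / 2 * qform (transpose A1 ** A1) (y - xh1)" for y
  define q2 where "q2 y = y \<bullet> grad (\<lambda>w. phi A1 A2 b \<beta> p1 w lh) xh2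
     + \<beta> / 2 * qform D (y - xh2) + \<sigma> * (1 - t) / (2 * t) * qform R (y - snd (x k))" for y
  have min1: "is_arg_min (\<lambda>y. f1 y + ereal (q1 y)) (\<lambda>_. True) p1"
    and min2: "is_arg_min (\<lambda>y. f2 y + ereal (q2 y)) (\<lambda>_. True) p2"
    using alg k(1) unfolding algorithm2_def Let_def q1_def q2_def t_def \<beta>_def xh1_def xh2_def lh_def
      p1_def p2_def R_def by auto
  have R: "transpose R = R" using D by (simp add: R_def transpose_scalar)
  define e where "e = A1 *v p1 + A2 *v xh2 - b"
  have p: "x (k + 1) = t *\<^sub>R xtilde \<tau> x k + (1 - t) *\<^sub>R x k"
    unfolding t_def by (rule x_Suc_eq[where \<tau> = \<tau>, OF k(2)])
  have h: "xhat \<tau> x k = t *\<^sub>R xbar \<tau> x k + (1 - t) *\<^sub>R x k"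
    unfolding t_def by (rule xhat_eq[where \<tau> = \<tau>, OF k(3)])
  \<comment> \<open>Both blocks of the mixed point are combinations with weights \<open>t\<close>
    and \<open>1 - t\<close>, so the residual splits into the one in \<open>lamtilde\<close> and the
    one at \<open>x k\<close>.\<close>
  have e: "e = t *\<^sub>R (A1 *v fst (xtilde \<tau> x k) + A2 *v snd (xbar \<tau> x k) - b)
     + (1 - t) *\<^sub>R (Aop A1 A2 (x k) - b)"
    unfolding e_def p1_def xh2_def p h Aop_def
    by (simp add: matrix_vector_right_distrib matrix_vector_mult_scaleR algebra_simps)
  \<comment> \<open>\<open>lamhat\<close> adds the fraction \<open>\<gamma>\<close> of the weighted
    residual at \<open>x k\<close> and the penalty subtracts all of it; this leaves the factor
    \<open>1 - \<gamma>\<close>.\<close>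
  have m: "lh - \<beta> *\<^sub>R e = m"
    unfolding m_def e lh_def lamhat_def lamtilde_def t_def[symmetric] \<beta>_def[symmetric]
    by (simp add: algebra_simps)
  have "GDERIV q1 p1 :> transpose A1 *v (\<beta> *\<^sub>R (A1 *v xh1 + A2 *v xh2 - b) - lh)
      + (2 * (\<beta> / 2)) *\<^sub>R ((transpose A1 ** A1) *v (p1 - xh1))"
    unfolding q1_def grad_eqI[OF GDERIV_phi1]
    by (intro GDERIV_add GDERIV_inner_left GDERIV_qform) (simp add: matrix_transpose_mul)
  then have "- (transpose A1 *v (\<beta> *\<^sub>R (A1 *v xh1 + A2 *v xh2 - b) - lh)
      + (2 * (\<beta> / 2)) *\<^sub>R ((transpose A1 ** A1) *v (p1 - xh1))) \<in> subdiff f1 p1"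
    by (rule subdiff_of_arg_min[OF f(1) min1])
  \<comment> \<open>The proximal matrix \<open>transpose A1 ** A1\<close> moves the linearization
    point of the penalty from \<open>xh1\<close> to \<open>p1\<close>, so no proximal term survives
    in the first block.\<close>
  also have "- (transpose A1 *v (\<beta> *\<^sub>R (A1 *v xh1 + A2 *v xh2 - b) - lh)
      + (2 * (\<beta> / 2)) *\<^sub>R ((transpose A1 ** A1) *v (p1 - xh1))) = transpose A1 *v m"
    unfolding m[symmetric] e_def
    by (simp add: matrix_vector_mul_assoc[symmetric] matrix_vector_right_distrib
        matrix_vector_mult_diff_distrib matrix_vector_mult_scaleR algebra_simps
        del: transpose_matrix_vector)
  finally show "transpose A1 *v m \<in> subdiff f1 (fst (x (k + 1)))" by (simp only: p1_def)
  have "GDERIV q2 p2 :> transpose A2 *v (\<beta> *\<^sub>R e - lh)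
      + (2 * (\<beta> / 2)) *\<^sub>R (D *v (p2 - xh2)) + (2 * (\<sigma> * (1 - t) / (2 * t))) *\<^sub>R (R *v (p2 - snd (x k)))"
    unfolding q2_def grad_eqI[OF GDERIV_phi2] e_def
    by (intro GDERIV_add GDERIV_inner_left GDERIV_qform D R)
  then have "- (transpose A2 *v (\<beta> *\<^sub>R e - lh)
      + (2 * (\<beta> / 2)) *\<^sub>R (D *v (p2 - xh2)) + (2 * (\<sigma> * (1 - t) / (2 * t))) *\<^sub>R (R *v (p2 - snd (x k))))
      \<in> subdiff f2 p2"
    by (rule subdiff_of_arg_min[OF f(2) min2])
  also have "p2 - xh2 = t *\<^sub>R (snd (xtilde \<tau> x k) - snd (xbar \<tau> x k))"
    unfolding p2_def xh2_def p h by (simp add: algebra_simps)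
  also have "transpose A2 *v (\<beta> *\<^sub>R e - lh) = - (transpose A2 *v m)"
    unfolding m[symmetric]
    by (simp add: matrix_vector_mult_diff_distrib del: transpose_matrix_vector)
  finally show "transpose A2 *v m - (\<tau> k * \<beta>s k) *\<^sub>R (D *v (snd (xtilde \<tau> x k) - snd (xbar \<tau> x k)))
      - (\<sigma> * (1 - \<tau> k) / \<tau> k) *\<^sub>R (R *v (snd (x (k + 1)) - snd (x k))) \<in> subdiff f2 (snd (x (k + 1)))"
    unfolding t_def[symmetric] \<beta>_def[symmetric] p2_def[symmetric]
    by (simp add: matrix_vector_mult_scaleR mult.commute del: transpose_matrix_vector)
  show "\<exists>r. fsum f1 f2 (x (k + 1)) = ereal r"
    using is_arg_min_finite[OF f(1) min1] is_arg_min_finite[OF f(2) min2]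
    unfolding fsum_def p1_def p2_def by (metis plus_ereal.simps(1))
qed

text \<open>Dividing this by \<open>\<tau>\<^sup>k\<close> gives (i) and by \<open>(\<tau>\<^sup>k)\<^sup>2\<close> gives (ii).\<close>

lemma algorithm2_step:
  fixes A1 :: "real^'n1^'l" and A2 :: "real^'n2^'l"
  assumes f: "closed_proper_convex f1" "closed_proper_convex f2"
    and \<sigma>: "0 \<le> \<sigma>" "strongly_convex \<sigma> f2"
    and alg: "algorithm2 A1 A2 b f1 f2 \<sigma> D \<gamma> \<beta>s \<tau> x lam"
    and k: "0 \<le> k" "0 < \<tau> k" "\<tau> k \<le> 1" "\<tau> (k - 1) \<noteq> 0" "\<beta>s k \<noteq> 0"
    and D: "transpose D = D"
    and R_def: "R = (1 / sigma_max D) *\<^sub>R D"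
    and R: "\<And>w. 0 \<le> qform R w" "\<And>w. qform R w \<le> (norm w)\<^sup>2"
    and vals: "fsum f1 f2 (y1, y2) = ereal a" "fsum f1 f2 (x k) = ereal c" "fsum f1 f2 (x (k + 1)) = ereal r"
  shows "\<tau> k * a + (1 - \<tau> k) * c - r
    \<ge> \<tau> k * ((stack y2 l - vtilde A1 A2 b \<beta>s \<tau> x lam k)
               \<bullet> (Qmat A2 D (\<tau> k) (\<beta>s k) *v (vseq \<tau> x lam k - vtilde A1 A2 b \<beta>s \<tau> x lam k))
           - ((y1, y2, l) - utilde A1 A2 b \<beta>s \<tau> x lam k) \<bullet> Fop A1 A2 b (utilde A1 A2 b \<beta>s \<tau> x lam k)
           - (1 - \<gamma>) * (1 - \<tau> k) * \<beta>s k * (Aop A1 A2 ((y1, y2) - xtilde \<tau> x k) \<bullet> (Aop A1 A2 (x k) - b))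
           + \<sigma> / 2 * qform R (snd (xtilde \<tau> x k) - y2))"
proof -
  define z1 z2 where "z1 = fst (xtilde \<tau> x k)" and "z2 = snd (xtilde \<tau> x k)"
  define lt where "lt = lamtilde A1 A2 b \<beta>s \<tau> x lam k"
  define m where "m = lt - ((1 - \<gamma>) * (1 - \<tau> k) * \<beta>s k) *\<^sub>R (Aop A1 A2 (x k) - b)"
  have nz: "\<tau> k \<noteq> 0" using k by simp
  have z: "xtilde \<tau> x k = (z1, z2)" by (simp add: z1_def z2_def)
  note opt = algorithm2_optimality[OF f alg k(1) nz k(4) D, folded R_def lt_def z2_def, folded m_def]
  have p: "(fst (x (k + 1)), snd (x (k + 1))) = \<tau> k *\<^sub>R (z1, z2) + (1 - \<tau> k) *\<^sub>R (fst (x k), snd (x k))"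
    using x_Suc_eq[where \<tau> = \<tau> and x = x, OF nz] by (simp only: z prod.collapse)
  have "transpose R = R" using D by (simp add: R_def transpose_scalar)
  note ineq = subdiff_pair_convex_combination[OF f \<sigma> k(2,3) p this R opt(1,2), unfolded prod.collapse, OF vals]
  have "\<tau> k * \<beta>s k \<noteq> 0" using k by simp
  note id = Qmat_Fop_identity[OF this lt_def[unfolded lamtilde_def, folded z1_def], of y2 l z2 D y1]
  \<comment> \<open>Trading \<open>m\<close> for the predicted multiplier \<open>lt\<close> creates
    the correction term with factor \<open>1 - \<gamma>\<close>.\<close>
  have "m \<bullet> Aop A1 A2 ((y1, y2) - (z1, z2)) = lt \<bullet> Aop A1 A2 ((y1, y2) - (z1, z2))
     - (1 - \<gamma>) * (1 - \<tau> k) * \<beta>s k * (Aop A1 A2 ((y1, y2) - (z1, z2)) \<bullet> (Aop A1 A2 (x k) - b))"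
    unfolding m_def inner_diff_left[of lt] by (simp add: inner_commute)
  with id have "m \<bullet> Aop A1 A2 ((y1, y2) - (z1, z2))
      - ((\<tau> k * \<beta>s k) *\<^sub>R (D *v (z2 - snd (xbar \<tau> x k)))) \<bullet> (y2 - z2)
    = (stack y2 l - stack z2 lt) \<bullet> (Qmat A2 D (\<tau> k) (\<beta>s k) *v (stack (snd (xbar \<tau> x k)) (lam k) - stack z2 lt))
      - ((y1, y2, l) - (z1, z2, lt)) \<bullet> Fop A1 A2 b (z1, z2, lt)
      - (1 - \<gamma>) * (1 - \<tau> k) * \<beta>s k * (Aop A1 A2 ((y1, y2) - (z1, z2)) \<bullet> (Aop A1 A2 (x k) - b))"
    unfolding inner_scaleR_left by linarith
  with ineq show ?thesis
    unfolding vtilde_def vseq_def utilde_def lt_def[symmetric] z1_def[symmetric] z2_def[symmetric] z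
    by simp
qed

section \<open>Bounds on the proximal matrix, prediction and correction, and parameters\<close>

lemma proximal_matrix_facts:
  fixes A2 :: "real^'n^'l"
  assumes "D = transpose A2 ** A2 \<or> D = (onorm ((*v) A2))\<^sup>2 *\<^sub>R mat 1"
  shows "transpose D = D" and "(norm (A2 *v w))\<^sup>2 \<le> qform D w"
proof -
  show "transpose D = D" using assms by (auto simp: matrix_transpose_mul transpose_scalar)
  have "w \<bullet> (transpose A2 *v (A2 *v w)) = (norm (A2 *v w))\<^sup>2"
    by (simp add: inner_vector_matrix_mult power2_norm_eq_inner)
  \<comment> \<open>This settles the multiple of the identity; for \<open>transpose A2 ** A2\<close>
    the claim is an equality.\<close>
  moreover have "(norm (A2 *v w))\<^sup>2 \<le> (onorm ((*v) A2) * norm w)\<^sup>2"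
    by (intro power_mono onorm matrix_vector_mul_bounded_linear) auto
  ultimately show "(norm (A2 *v w))\<^sup>2 \<le> qform D w" using assms
    by (auto simp: qform_def scaleR_matrix_vector_assoc[symmetric] matrix_vector_mul_assoc[symmetric]
        power_mult_distrib power2_norm_eq_inner simp del: transpose_matrix_vector)
qed

lemma qform_normalized_bounds:
  fixes D :: "real^'n^'n"
  assumes "transpose D = D" and pos: "\<And>w. 0 \<le> qform D w"
  shows "0 \<le> sigma_max D" "0 \<le> qform ((1 / sigma_max D) *\<^sub>R D) w"
    "qform ((1 / sigma_max D) *\<^sub>R D) w \<le> (norm w)\<^sup>2"
proof -
  note le = qform_le_sigma_max[OF assms(1)]
  show s: "0 \<le> sigma_max D"
    using order_trans[OF pos le, of "axis undefined 1"] by (simp add: norm_axis_1)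
  show "0 \<le> qform ((1 / sigma_max D) *\<^sub>R D) w" using s pos by (simp add: qform_scaleR)
  show "qform ((1 / sigma_max D) *\<^sub>R D) w \<le> (norm w)\<^sup>2"
    \<comment> \<open>If the largest eigenvalue is 0, then \<open>1 / 0 = 0\<close> turns the
      normalized form into 0.\<close>
    using s le[of w] by (cases "sigma_max D = 0") (auto simp: qform_scaleR qform_def[of 0] field_simps)
qed

text \<open>For \<open>a = \<infinity>\<close> the left-hand side is \<open>\<infinity>\<close>, even when \<open>c = \<infinity>\<close>, because \<open>\<infinity> - \<infinity> = \<infinity>\<close> in \<open>ereal\<close>.\<close>

lemma ereal_weighted_difference_ge:
  assumes "a \<noteq> - \<infinity>" "c \<noteq> - \<infinity>" "0 < p" "0 < q"
    and "\<And>a' c'. a = ereal a' \<Longrightarrow> c = ereal c' \<Longrightarrow> w \<le> p * (a' - r) - q * (a' - c') + e"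
  shows "ereal w \<le> ereal p * (a - ereal r) - ereal q * (a - c) + ereal e"
  using assms by (cases a; cases c) auto

text \<open>Brings the difference into the shape of \<open>qform_Gmat_ge\<close>, with the residual
  at the predicted point as \<open>\<rho>\<close>.\<close>

lemma vseq_diff_vtilde:
  "vseq \<tau> x lam k - vtilde A1 A2 b \<beta>s \<tau> x lam k
    = stack (snd (xbar \<tau> x k) - snd (xtilde \<tau> x k))
        ((\<tau> k * \<beta>s k) *\<^sub>R (Aop A1 A2 (xtilde \<tau> x k) - b + A2 *v (snd (xbar \<tau> x k) - snd (xtilde \<tau> x k))))"
  by (simp add: vseq_def vtilde_def lamtilde_def stack_diff Aop_def matrix_vector_mult_diff_distrib
      algebra_simps)

text \<open>In the lower row of \<open>Mmat\<close> the two \<open>A2\<close> terms cancel, which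
  leaves exactly the multiplier update; the upper row replaces \<open>xbar\<close> by the predicted
  block.\<close>

lemma vseq_Suc:
  assumes "lam (k + 1) = lam k - (\<gamma> * \<tau> k * \<beta>s k) *\<^sub>R (Aop A1 A2 (xbar \<tau> x (k + 1)) - b)"
  shows "vseq \<tau> x lam (k + 1) = vseq \<tau> x lam k
    - Mmat A2 \<gamma> (\<tau> k) (\<beta>s k) *v (vseq \<tau> x lam k - vtilde A1 A2 b \<beta>s \<tau> x lam k)"
  unfolding vseq_diff_vtilde Mmat_def block_mult_stack
  unfolding vseq_def stack_diff assms xtilde_def
  by (simp add: uminus_matrix_vector_mult
      scaleR_matrix_vector_assoc[symmetric] algebra_simps)

lemma partial_sums_int:
  fixes c :: "int \<Rightarrow> real"
  assumes "\<And>k. k \<ge> 0 \<Longrightarrow> c k \<ge> 0"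
  obtains \<Theta> :: "int \<Rightarrow> real" where "\<And>k. k \<ge> 0 \<Longrightarrow> \<Theta> k \<ge> 0" "\<And>k. k \<ge> 0 \<Longrightarrow> \<Theta> (k + 1) - \<Theta> k = c k"
proof
  have "{0..<k + 1} = insert k {0..<k}" if "k \<ge> 0" for k :: int using that by auto
  then show "sum c {0..<k + 1} - sum c {0..<k} = c k" if "k \<ge> 0" for k using that by simp
  show "sum c {0..<k} \<ge> 0" for k using assms by (intro sum_nonneg) auto
qed

text \<open>A positive value of \<open>(1 - s) / s\<close> forces \<open>s\<close> into the open
  unit interval, so the bounds propagate along the recurrence from index -1.\<close>

lemma relaxation_parameter_bounds:
  fixes \<tau> :: "int \<Rightarrow> real"
  assumes "0 < \<tau> (- 1)" "\<tau> (- 1) < 1" and rec: "\<And>k. k \<ge> 0 \<Longrightarrow> 1 / \<tau> (k - 1) = (1 - \<tau> k) / \<tau> k"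
  shows "k \<ge> - 1 \<Longrightarrow> 0 < \<tau> k \<and> \<tau> k < 1"
proof (induction k rule: int_ge_induct)
  case base
  then show ?case using assms by simp
next
  case (step i)
  then have "(1 - \<tau> (i + 1)) / \<tau> (i + 1) = 1 / \<tau> i" using rec[of "i + 1"] by simp
  also have "\<dots> > 0" using step by simp
  finally show ?case by (auto simp: zero_less_divide_iff)
qed

section \<open>The convex and the strongly convex case\<close>

theorem theorem5p3:
  fixes A1 :: "real^'n1^'l" and A2 :: "real^'n2^'l" and b :: "real^'l"
    and f1 :: "real^'n1 \<Rightarrow> ereal" and f2 :: "real^'n2 \<Rightarrow> ereal"
    and \<sigma> \<gamma> \<beta> :: real and D :: "real^'n2^'n2"
    and \<tau> \<beta>s :: "int \<Rightarrow> real"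
    and x :: "int \<Rightarrow> (real^'n1) \<times> (real^'n2)" and lam :: "int \<Rightarrow> real^'l"
  assumes f1: "closed_proper_convex f1"
    and f2: "closed_proper_convex f2"
    and \<sigma>: "\<sigma> \<ge> 0" "strongly_convex \<sigma> f2"
    and \<gamma>: "0 < \<gamma>" "\<gamma> \<le> 1"
    and D: "D = transpose A2 ** A2 \<or> D = (onorm ((*v) A2))\<^sup>2 *\<^sub>R mat 1"
    and \<beta>: "\<beta> > 0"
    and alg: "algorithm2 A1 A2 b f1 f2 \<sigma> D \<gamma> \<beta>s \<tau> x lam"
  shows "let f = fsum f1 f2; A = Aop A1 A2; F = Fop A1 A2 b; R = (1 / sigma_max D) *\<^sub>R D;
             xb = xbreve x; xt = xtilde \<tau> x;
             v = vseq \<tau> x lam; vt = vtilde A1 A2 b \<beta>s \<tau> x lam; ut = utilde A1 A2 b \<beta>s \<tau> x lam;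
             Q = (\<lambda>k. Qmat A2 D (\<tau> k) (\<beta>s k)); M = (\<lambda>k. Mmat A2 \<gamma> (\<tau> k) (\<beta>s k));
             H = (\<lambda>k. Hmat D \<gamma> (\<tau> k) (\<beta>s k)); G = (\<lambda>k. Gmat A2 D \<gamma> (\<tau> k) (\<beta>s k))
    in
    \<comment> \<open>(i)\<close>
    (\<sigma> = 0 \<and> (\<forall>k\<ge>0. \<beta>s k = \<beta> / \<tau> k)
      \<and> (\<forall>k\<ge>0. 1 / \<tau> (k - 1) = (1 - \<tau> k) / \<tau> k) \<and> 0 < \<tau> (-1) \<and> \<tau> (-1) < 1
     \<longrightarrow>
      (\<forall>k\<ge>0.
         xt k = (1 / \<tau> k) *\<^sub>R xb k - ((1 - \<tau> k) / \<tau> k) *\<^sub>R xb (k - 1)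
       \<and> (\<forall>x1 x2 l. let c = (1 - \<gamma>) * (1 - \<tau> k) * \<beta>s k in
            ereal (1 / \<tau> k) * (f (x1, x2) - f (xb k))
            - ereal (1 / \<tau> (k - 1)) * (f (x1, x2) - f (xb (k - 1)))
            + ereal (((x1, x2, l) - ut k) \<bullet> F (ut k)
                     + c * (A ((x1, x2) - xt k) \<bullet> (A (xb (k - 1)) - b)))
            \<ge> ereal ((stack x2 l - vt k) \<bullet> (Q k *v (v k - vt k))))
       \<and> v (k + 1) = v k - M k *v (v k - vt k)
       \<and> Q k = H k ** M k
       \<and> G k = transpose (Q k) + Q k - transpose (M k) ** H k ** M k
       \<and> H k = block (\<beta> *\<^sub>R D) 0 0 ((1 / (\<gamma> * \<beta>)) *\<^sub>R mat 1))
      \<and> (let H0 = H in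
         \<exists>\<Theta>::int \<Rightarrow> real.
           (\<forall>k\<ge>0. \<Theta> k \<ge> 0
             \<and> \<Theta> (k + 1) - \<Theta> k \<ge> (1 - \<gamma>) * \<tau> k * \<beta>s k * (norm (A (xt k) - b))\<^sup>2)
         \<and> (\<forall>k\<ge>0. \<forall>x1' x2' l. (x1', x2') \<in> Omega A1 A2 b \<longrightarrow>
             (let v' = stack x2' l in
                qform (H k) (v (k + 1) - v') - qform (H k) (v k - v') + qform (G k) (v k - vt k)
                \<ge> qform (H0 (k + 1)) (v (k + 1) - v') - qform (H0 k) (v k - v')
                   + \<Theta> (k + 1) - \<Theta> k))))
    \<and>
    \<comment> \<open>(ii)\<close>
    (\<sigma> > 0 \<and> (\<forall>k\<ge>0. \<beta>s k = \<beta> / (\<tau> k)\<^sup>2)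
      \<and> (\<forall>k\<ge>0. 1 / \<tau> k * (\<beta> / \<tau> k + \<sigma> / sigma_max D) \<ge> \<beta> / (\<tau> (k + 1))\<^sup>2)
      \<and> (\<forall>k\<ge>0. \<tau> k > 0) \<and> (\<forall>k\<ge>0. 1 / (\<tau> (k - 1))\<^sup>2 = (1 - \<tau> k) / (\<tau> k)\<^sup>2)
      \<and> 0 < \<tau> (-1) \<and> \<tau> (-1) < 1
     \<longrightarrow>
      (\<forall>k\<ge>0.
         xt k = (1 / \<tau> k) *\<^sub>R xb k - ((1 - \<tau> k) / \<tau> k) *\<^sub>R xb (k - 1)
       \<and> (\<forall>x1 x2 l. let c = (1 - \<gamma>) * (1 - \<tau> k) * \<beta>s k / \<tau> k in
            ereal (1 / (\<tau> k)\<^sup>2) * (f (x1, x2) - f (xb k))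
            - ereal (1 / (\<tau> (k - 1))\<^sup>2) * (f (x1, x2) - f (xb (k - 1)))
            + ereal (1 / \<tau> k * (((x1, x2, l) - ut k) \<bullet> F (ut k))
                     + c * (A ((x1, x2) - xt k) \<bullet> (A (xb (k - 1)) - b)))
            \<ge> ereal (1 / \<tau> k * ((stack x2 l - vt k) \<bullet> (Q k *v (v k - vt k))
                                 + \<sigma> / 2 * qform R (snd (xt k) - x2))))
       \<and> v (k + 1) = v k - M k *v (v k - vt k)
       \<and> Q k = H k ** M k
       \<and> G k = transpose (Q k) + Q k - transpose (M k) ** H k ** M k
       \<and> (1 / \<tau> k) *\<^sub>R H k = block ((\<beta> / (\<tau> k)\<^sup>2) *\<^sub>R D) 0 0 ((1 / (\<gamma> * \<beta>)) *\<^sub>R mat 1))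
      \<and> (let H0 = (\<lambda>k. (1 / \<tau> k) *\<^sub>R H k) in
         \<exists>\<Theta>::int \<Rightarrow> real.
           (\<forall>k\<ge>0. \<Theta> k \<ge> 0
             \<and> \<Theta> (k + 1) - \<Theta> k \<ge> (1 - \<gamma>) * \<beta>s k * (norm (A (xt k) - b))\<^sup>2)
         \<and> (\<forall>k\<ge>0. \<forall>x1' x2' l. (x1', x2') \<in> Omega A1 A2 b \<longrightarrow>
             (let v' = stack x2' l in
                1 / \<tau> k * (qform (H k) (v (k + 1) - v') + \<sigma> * qform R (snd (xt k) - x2')
                            - qform (H k) (v k - v') + qform (G k) (v k - vt k))
                \<ge> qform (H0 (k + 1)) (v (k + 1) - v') - qform (H0 k) (v k - v')
                   + \<Theta> (k + 1) - \<Theta> k))))"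
proof -
  note Dt = proximal_matrix_facts(1)[OF D] and Dge = proximal_matrix_facts(2)[OF D]
  have Dpos: "0 \<le> qform D w" for w using Dge[of w] zero_le_power2 by (rule order_trans[rotated])
  define R where "R = (1 / sigma_max D) *\<^sub>R D"
  note R = qform_normalized_bounds(2,3)[OF Dt Dpos, folded R_def]
  have ninf: "fsum f1 f2 y \<noteq> - \<infinity>" for y
    using f1 f2 by (simp add: fsum_def closed_proper_convex_def)
  have lam: "lam (k + 1) = lam k - (\<gamma> * \<tau> k * \<beta>s k) *\<^sub>R (Aop A1 A2 (xbar \<tau> x (k + 1)) - b)" if "k \<ge> 0" for k
    using alg that by (auto simp: algorithm2_def Let_def)
  note v_Suc = vseq_Suc[where \<gamma> = \<gamma> and \<tau> = \<tau> and \<beta>s = \<beta>s and x = x and lam = lam, OF lam]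
  have xt: "xtilde \<tau> x k = (1 / \<tau> k) *\<^sub>R xbreve x k - ((1 - \<tau> k) / \<tau> k) *\<^sub>R xbreve x (k - 1)" for k
    by (simp add: xtilde_def xbreve_def xbar_def)
  have G: "(1 - \<gamma>) * \<tau> k * \<beta>s k * (norm (Aop A1 A2 (xtilde \<tau> x k) - b))\<^sup>2
      \<le> qform (Gmat A2 D \<gamma> (\<tau> k) (\<beta>s k)) (vseq \<tau> x lam k - vtilde A1 A2 b \<beta>s \<tau> x lam k)"
    if "\<tau> k * \<beta>s k > 0" for k
    unfolding vseq_diff_vtilde by (rule qform_Gmat_ge[OF that Dge])
  note step = algorithm2_step[OF f1 f2 \<sigma> alg _ _ _ _ _ Dt R_def R]
  have rn: "\<exists>r. fsum f1 f2 (x (k + 1)) = ereal r" if "0 \<le> k" "\<tau> k > 0" "\<tau> (k - 1) > 0" for k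
    using algorithm2_optimality(3)[OF f1 f2 alg _ _ _ Dt, of k] that by simp
  show ?thesis unfolding Let_def R_def[symmetric]
  \<comment> \<open>Four goals arise: for each of the two cases, first the identities with the
    variational inequality, then the contraction with \<open>\<Theta>\<close>.\<close>
  proof (intro conjI impI, goal_cases)
    case 1
    then have s0: "\<sigma> = 0" and \<beta>s: "\<And>k. k \<ge> 0 \<Longrightarrow> \<beta>s k = \<beta> / \<tau> k"
      and rec: "\<And>k. k \<ge> 0 \<Longrightarrow> 1 / \<tau> (k - 1) = (1 - \<tau> k) / \<tau> k" and \<tau>0: "0 < \<tau> (- 1)" "\<tau> (- 1) < 1" by auto
    note \<tau> = relaxation_parameter_bounds[OF \<tau>0 rec]
    have \<tau>p: "\<tau> k > 0" "\<tau> (k - 1) > 0" "\<tau> k < 1" if "k \<ge> 0" for k using \<tau>[of k] \<tau>[of "k - 1"] that by auto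
    have \<tau>\<beta>: "\<tau> k * \<beta>s k = \<beta>" "\<beta>s k > 0" if "k \<ge> 0" for k using \<tau>p[OF that] \<beta>s[OF that] \<beta> by auto
    show ?case
    proof (intro allI impI conjI, goal_cases)
      case (2 k x1 x2 l)
      obtain r where r: "fsum f1 f2 (x (k + 1)) = ereal r" using rn[of k] \<tau>p[OF 2] 2 by auto
      have xk: "xbreve x k = x (k + 1)" "xbreve x (k - 1) = x k" by (simp_all add: xbreve_def)
      show ?case unfolding xk r
      proof (rule ereal_weighted_difference_ge[OF ninf ninf], goal_cases)
        case (3 a c)
        have t: "\<tau> k \<noteq> 0" using \<tau>p[OF 2] by simp
        note st = step[OF 2 \<tau>p(1)[OF 2] less_imp_le[OF \<tau>p(3)[OF 2]] less_imp_neq[OF \<tau>p(2)[OF 2], symmetric]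
            less_imp_neq[OF \<tau>\<beta>(2)[OF 2], symmetric] 3 r, where l = l]
        \<comment> \<open>The recurrence makes the two weights of \<open>a\<close> differ by exactly
          1, so the objective terms are those of \<open>step\<close> divided by
          \<open>\<tau> k\<close>.\<close>
        have eq: "1 / \<tau> k * (a - r) - 1 / \<tau> (k - 1) * (a - c) = (\<tau> k * a + (1 - \<tau> k) * c - r) / \<tau> k"
          unfolding rec[OF 2] using t by (simp add: field_simps)
        show ?case
          using divide_right_mono[OF st less_imp_le[OF \<tau>p(1)[OF 2]]]
          unfolding eq nonzero_mult_div_cancel_left[OF t] s0 by simp
      qed (use \<tau>p[OF 2] in auto)
    next
      case (6 k)
      then show ?case using \<tau>\<beta>[of k] by (simp add: Hmat_def mult.assoc)
    qed (use \<tau>\<beta> \<gamma> \<beta> in \<open>auto intro: xt v_Suc Qmat_eq Gmat_eq[OF _ _ Dt]\<close>)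
  next
    case 2
    then have \<beta>s: "\<And>k. k \<ge> 0 \<Longrightarrow> \<beta>s k = \<beta> / \<tau> k"
      and rec: "\<And>k. k \<ge> 0 \<Longrightarrow> 1 / \<tau> (k - 1) = (1 - \<tau> k) / \<tau> k" and \<tau>0: "0 < \<tau> (- 1)" "\<tau> (- 1) < 1" by auto
    note \<tau> = relaxation_parameter_bounds[OF \<tau>0 rec]
    have \<tau>p: "\<tau> k > 0" if "k \<ge> 0" for k using \<tau>[of k] that by auto
    have \<tau>\<beta>: "\<tau> k * \<beta>s k = \<beta>" if "k \<ge> 0" for k using \<tau>p[OF that] \<beta>s[OF that] \<beta> by auto
    obtain \<Theta> :: "int \<Rightarrow> real" where \<Theta>: "\<And>k. k \<ge> 0 \<Longrightarrow> \<Theta> k \<ge> 0"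
      "\<And>k. k \<ge> 0 \<Longrightarrow> \<Theta> (k + 1) - \<Theta> k = (1 - \<gamma>) * \<tau> k * \<beta>s k * (norm (Aop A1 A2 (xtilde \<tau> x k) - b))\<^sup>2"
      by (rule partial_sums_int[of "\<lambda>k. (1 - \<gamma>) * \<tau> k * \<beta>s k * (norm (Aop A1 A2 (xtilde \<tau> x k) - b))\<^sup>2"])
        (use \<gamma> \<tau>\<beta> \<beta> in \<open>auto simp: mult.assoc\<close>)
    show ?case
    proof (intro exI[of _ \<Theta>] conjI allI impI, goal_cases)
      case (3 k x1' x2' l)
      \<comment> \<open>\<open>\<tau> k * \<beta>s k\<close> is the constant \<open>\<beta>\<close>,
        so all terms in \<open>Hmat\<close> cancel and only the bound \<open>G\<close> remains to be
        used.\<close>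
      have H: "Hmat D \<gamma> (\<tau> (k + 1)) (\<beta>s (k + 1)) = (Hmat D \<gamma> (\<tau> k) (\<beta>s k) :: real^('n2 + 'l)^('n2 + 'l))"
        using \<tau>\<beta>[of k] \<tau>\<beta>[of "k + 1"] 3 by (simp add: Hmat_def mult.assoc)
      show ?case unfolding H using G[of k] \<Theta>(2)[of k] \<tau>\<beta>[of k] \<beta> 3 by simp
    qed (use \<Theta> in auto)
  next
    case 3
    then have \<beta>s: "\<And>k. k \<ge> 0 \<Longrightarrow> \<beta>s k = \<beta> / (\<tau> k)\<^sup>2" and \<tau>p: "\<And>k. k \<ge> 0 \<Longrightarrow> \<tau> k > 0"
      and rec: "\<And>k. k \<ge> 0 \<Longrightarrow> 1 / (\<tau> (k - 1))\<^sup>2 = (1 - \<tau> k) / (\<tau> k)\<^sup>2" and \<tau>0: "0 < \<tau> (- 1)" by auto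
    \<comment> \<open>At \<open>k = 0\<close> the index is -1, where positivity is a separate
      hypothesis.\<close>
    have \<tau>q: "\<tau> (k - 1) > 0" if "k \<ge> 0" for k
      using \<tau>p[of "k - 1"] \<tau>0 that by (cases "k = 0") auto
    have \<tau>1: "\<tau> k < 1" if "k \<ge> 0" for k
    proof -
      have "0 < (1 - \<tau> k) / (\<tau> k)\<^sup>2" unfolding rec[OF that, symmetric] using \<tau>q[OF that] by simp
      then show ?thesis using \<tau>p[OF that] by (simp add: zero_less_divide_iff)
    qed
    have \<beta>p: "\<beta>s k > 0" if "k \<ge> 0" for k using \<tau>p[OF that] \<beta>s[OF that] \<beta> by simp
    have nz: "\<tau> k * \<beta>s k \<noteq> 0" if "k \<ge> 0" for k using \<tau>p[OF that] \<beta>p[OF that] by simp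
    show ?case
    proof (intro allI impI conjI, goal_cases)
      case (2 k x1 x2 l)
      obtain r where r: "fsum f1 f2 (x (k + 1)) = ereal r" using rn[of k] \<tau>p[OF 2] \<tau>q[OF 2] 2 by auto
      have xk: "xbreve x k = x (k + 1)" "xbreve x (k - 1) = x k" by (simp_all add: xbreve_def)
      show ?case unfolding xk r
      proof (rule ereal_weighted_difference_ge[OF ninf ninf], goal_cases)
        case (3 a c)
        have t: "\<tau> k \<noteq> 0" using \<tau>p[OF 2] by simp
        note st = step[OF 2 \<tau>p[OF 2] less_imp_le[OF \<tau>1[OF 2]] less_imp_neq[OF \<tau>q[OF 2], symmetric]
            less_imp_neq[OF \<beta>p[OF 2], symmetric] 3 r, where l = l]
        have eq: "1 / (\<tau> k)\<^sup>2 * (a - r) - 1 / (\<tau> (k - 1))\<^sup>2 * (a - c) = (\<tau> k * a + (1 - \<tau> k) * c - r) / (\<tau> k)\<^sup>2"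
          unfolding rec[OF 2] using t by (simp add: field_simps)
        have mul: "\<tau> k * Z / (\<tau> k)\<^sup>2 = 1 / \<tau> k * Z" for Z using t by (simp add: power2_eq_square)
        show ?case
          using divide_right_mono[OF st zero_le_power2[of "\<tau> k"]]
          unfolding eq mul by (simp add: diff_divide_distrib add_divide_distrib)
      qed (use \<tau>p[OF 2] \<tau>q[OF 2] in auto)
    next
      case (6 k)
      then show ?case using \<tau>p[of k] \<beta>s[of k]
        by (simp add: Hmat_def scaleR_block power2_eq_square)
    qed (use nz \<gamma> in \<open>auto intro: xt v_Suc Qmat_eq Gmat_eq[OF _ _ Dt]\<close>)
  next
    case 4
    then have \<beta>s: "\<And>k. k \<ge> 0 \<Longrightarrow> \<beta>s k = \<beta> / (\<tau> k)\<^sup>2" and \<tau>p: "\<And>k. k \<ge> 0 \<Longrightarrow> \<tau> k > 0"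
      and ge: "\<And>k. k \<ge> 0 \<Longrightarrow> \<beta> / (\<tau> (k + 1))\<^sup>2 \<le> 1 / \<tau> k * (\<beta> / \<tau> k + \<sigma> / sigma_max D)" by auto
    have \<beta>p: "\<beta>s k > 0" if "k \<ge> 0" for k using \<tau>p[OF that] \<beta>s[OF that] \<beta> by simp
    obtain \<Theta> :: "int \<Rightarrow> real" where \<Theta>: "\<And>k. k \<ge> 0 \<Longrightarrow> \<Theta> k \<ge> 0"
      "\<And>k. k \<ge> 0 \<Longrightarrow> \<Theta> (k + 1) - \<Theta> k = (1 - \<gamma>) * \<beta>s k * (norm (Aop A1 A2 (xtilde \<tau> x k) - b))\<^sup>2"
      by (rule partial_sums_int[of "\<lambda>k. (1 - \<gamma>) * \<beta>s k * (norm (Aop A1 A2 (xtilde \<tau> x k) - b))\<^sup>2"])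
        (use \<gamma> in \<open>auto intro!: mult_nonneg_nonneg less_imp_le[OF \<beta>p]\<close>)
    \<comment> \<open>After scaling, the multiplier block no longer depends on \<open>k\<close>;
      only the weight of \<open>D\<close> changes between iterations.\<close>
    have H: "qform ((1 / \<tau> k) *\<^sub>R Hmat D \<gamma> (\<tau> k) (\<beta>s k)) (stack y z :: real^('n2 + 'l))
        = \<beta> / (\<tau> k)\<^sup>2 * qform D y + 1 / (\<gamma> * \<beta>) * (norm z)\<^sup>2" if "k \<ge> 0" for k y z
      using \<tau>p[OF that] by (simp add: qform_scaleR qform_Hmat \<beta>s[OF that] power2_eq_square distrib_left)
    show ?case
    proof (intro exI[of _ \<Theta>] conjI allI impI, goal_cases)
      case (3 k x1' x2' l)
      define y where "y = snd (xtilde \<tau> x k) - x2'"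
      have vd: "vseq \<tau> x lam (k + 1) - stack x2' l = stack y (lam (k + 1) - l)"
        by (simp add: vseq_def xtilde_def y_def stack_diff)
      \<comment> \<open>Any growth of the weight of \<open>D\<close> from \<open>k\<close> to
        \<open>k + 1\<close> is paid for by strong convexity, since
        \<open>\<sigma> / sigma_max D\<close> times the form of \<open>D\<close> is
        \<open>\<sigma>\<close> times the form of \<open>R\<close>.\<close>
      have "\<beta> / (\<tau> (k + 1))\<^sup>2 * qform D y \<le> 1 / \<tau> k * (\<beta> / \<tau> k + \<sigma> / sigma_max D) * qform D y"
        by (rule mult_right_mono[OF ge Dpos]) (rule 3)
      also have "\<dots> = \<beta> / (\<tau> k)\<^sup>2 * qform D y + 1 / \<tau> k * (\<sigma> * qform R y)"
        by (simp add: R_def qform_scaleR power2_eq_square algebra_simps)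
      finally have "qform ((1 / \<tau> (k + 1)) *\<^sub>R Hmat D \<gamma> (\<tau> (k + 1)) (\<beta>s (k + 1))) (stack y (lam (k + 1) - l))
          \<le> qform ((1 / \<tau> k) *\<^sub>R Hmat D \<gamma> (\<tau> k) (\<beta>s k)) (stack y (lam (k + 1) - l))
            + 1 / \<tau> k * (\<sigma> * qform R y)"
        using 3 by (simp add: H)
      moreover have "(1 - \<gamma>) * \<beta>s k * (norm (Aop A1 A2 (xtilde \<tau> x k) - b))\<^sup>2 \<le> 1 / \<tau> k *
         qform (Gmat A2 D \<gamma> (\<tau> k) (\<beta>s k)) (vseq \<tau> x lam k - vtilde A1 A2 b \<beta>s \<tau> x lam k)"
        using G[of k] \<tau>p[of k] \<beta>p[of k] 3 by (simp add: field_simps)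
      ultimately show ?case unfolding vd y_def[symmetric] qform_scaleR distrib_left right_diff_distrib
        using \<Theta>(2)[OF 3(1)] by linarith
    qed (use \<Theta> in auto)
  qed
qed

end
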